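(* Let $\mu_1,\mu_2,\mu_3$ be partitions and let $(A,B)$ be an $AB$ configuration for $(\mu_1,\mu_2,\mu_3)$. Then $(A,B)$ is a labelled $AB$ configuration if and only if the double-dimer configuration $D_{(A,B)}$ on the infinite honeycomb graph $H$ has the property that each (bi-infinite) path in $D_{(A,B)}$ starts and ends in the same sector.
   Context: A partition $\lambda=(\lambda_1\ge\dots\ge\lambda_k>0)$ (possibly empty) is identified with its Young diagram $\{(u,v)\in\mathbb{Z}_{\ge0}^2 : v<k,\ u<\lambda_{v+1}\}$. Fix partitions $\mu_1,\mu_2,\mu_3$. Elements of $\mathbb{Z}^3$ are called cells or boxes. Define $$\mathrm{Cyl}_1=\{(x,u,v)\in\mathbb{Z}^3:(u,v)\in\mu_1\},\quad \mathrm{Cyl}_2=\{(v,y,u)\in\mathbb{Z}^3:(u,v)\in\mu_2\},\quad \mathrm{Cyl}_3=\{(u,v,z)\in\mathbb{Z}^3:(u,v)\in\mu_3\},$$ and $\mathrm{Cyl}_i^-=\mathrm{Cyl}_i\setminus\mathbb{Z}_{\ge0}^3$, $\mathrm{I}^-=\mathrm{Cyl}_1^-\cup\mathrm{Cyl}_2^-\cup\mathrm{Cyl}_3^-$; $\mathrm{II}_{\bar1}=(\mathrm{Cyl}_2\cap\mathrm{Cyl}_3)\setminus\mathrm{Cyl}_1$, $\mathrm{II}_{\bar2}=(\mathrm{Cyl}_3\cap\mathrm{Cyl}_1)\setminus\mathrm{Cyl}_2$, $\mathrm{II}_{\bar3}=(\mathrm{Cyl}_1\cap\mathrm{Cyl}_2)\setminus\mathrm{Cyl}_3$,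 $\mathrm{II}=\mathrm{II}_{\bar1}\cup\mathrm{II}_{\bar2}\cup\mathrm{II}_{\bar3}$; $\mathrm{III}=\mathrm{Cyl}_1\cap\mathrm{Cyl}_2\cap\mathrm{Cyl}_3$. **$AB$ configurations.** An $AB$ configuration is a pair $(A,B)$ of finite sets $A\subseteq\mathrm{I}^-\cup\mathrm{III}$ and $B\subseteq\mathrm{II}\cup\mathrm{III}$ such that: if $w=(w_1,w_2,w_3)\in\mathrm{I}^-\cup\mathrm{III}$ (resp. $w\in\mathrm{II}\cup\mathrm{III}$) and at least one of $(w_1-1,w_2,w_3)$, $(w_1,w_2-1,w_3)$, $(w_1,w_2,w_3-1)$ belongs to $A$ (resp. $B$), then $w\in A$ (resp. $w\in B$). Two cells are adjacent if they differ by $\pm$ a standard basis vector. $(A,B)$ is a labelled $AB$ configuration if no connected component of $(\mathrm{I}^-\cap A)\cup(\mathrm{II}\setminus B)\cup(\mathrm{III}\cap(A\triangle B))$ contains both a cell of $\mathrm{Cyl}_i^-\cup\mathrm{II}_{\bar i}$ and a cell of $\mathrm{Cyl}_j^-\cup\mathrm{II}_{\bar j}$ for some $i\neq j$. **Tilings and dimers.** Let $p:\mathbb{R}^3\to\mathbb{R}^3/\mathbb{R}(1,1,1)\cong\mathbb{R}^2$ be the projection. The points $p(\mathbb{Z}^3)$ are the vertices of the triangular lattice with edges in the directions $p(e_1),p(e_2),p(e_3)$; the infinite honeycomb graph $H$ is its dual graph (vertices of $H$ = unit triangles; edges of $H$ = pairs of triangles sharing an edge; faces of $H$ = lattice points).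 Let $U\subseteq\mathbb{Z}^3$ be down-closed for the product order and such that every line $\{w+t(1,1,1):t\in\mathbb{Z}\}$, $w\in\mathbb{Z}^3$, meets both $U$ and its complement. Then the boundary surface of the solid $\bigcup_{w\in U}(w+[0,1]^3)$ is a union of unit squares which $p$ maps bijectively onto the plane, giving a lozenge tiling of the plane; each lozenge is a union of two adjacent triangles, hence an edge of $H$, and the tiling gives a dimer configuration (perfect matching) of $H$. Given an $AB$ configuration $(A,B)$, set $$U_A=\{w\in\mathbb{Z}^3: w\text{ has at least two negative coordinates}\}\cup\big((\mathrm{I}^-\cup\mathrm{III})\setminus A\big),$$ $$U_B=\big(\mathbb{Z}^3\setminus\mathbb{Z}_{\ge0}^3\big)\cup\big((\mathrm{II}\cup\mathrm{III})\setminus B\big).$$ (Each of $U=U_A$ and $U=U_B$ is down-closed for the product order, and every line $\{w+t(1,1,1):t\in\mathbb{Z}\}$, $w\in\mathbb{Z}^3$, meets both $U$ and its complement; these sets encode the surfaces of $(\mathrm{I}^-\cup\mathrm{III})\setminus A$ and $(\mathrm{II}\cup\mathrm{III})\setminus B$ viewed as lozenge tilings and extended to tilings of the whole plane.) Let $M_A$ and $M_B$ be the dimer configurations of $H$ given by the lozenge tilings obtained from $U_A$ and $U_B$, respectively. The double-dimer configuration $D_{(A,B)}$ is the superposition (multiset union of edges) of $M_A$ and $M_B$; its connected components are doubled edges, closed loops, and bi-infinite paths. **Sectors.** The three rays $p(\mathbb{R}_{\ge0}e_1)$, $p(\mathbb{R}_{\ge0}e_2)$, $p(\mathbb{R}_{\ge0}e_3)$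 (the projected coordinate axes) divide the plane into three sectors; sector $i$ is the one bounded by the two rays $p(\mathbb{R}_{\ge0}e_j)$, $j\ne i$ (so it contains $p(-e_i)$). Each bi-infinite path in $D_{(A,B)}$ crosses each of these rays only finitely many times, so each of its two ends is eventually contained in a single sector; the path starts and ends in the same sector if these two sectors coincide. *)

theory Defs
  imports "HOL-Analysis.Analysis"
begin

section \<open>Partitions, cylinders and AB configurations\<close>

definition is_partition :: "nat list \<Rightarrow> bool" where
  "is_partition la \<longleftrightarrow> sorted_wrt (\<ge>) la \<and> 0 \<notin> set la"

definition young_diagram :: "nat list \<Rightarrow> (int \<times> int) set" where
  "young_diagram la =
     {(u, v). 0 \<le> u \<and> 0 \<le> v \<and> v < int (length la) \<and> u < int (la ! nat v)}"

type_synonym cell = "int ^ 3"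

text \<open>
  The index type \<open>3\<close> is the ring of integers modulo 3, in which \<open>3 = 0\<close>: index arithmetic is cyclic,
  and for every \<open>i\<close> the two other indices are \<open>i + 1\<close> and \<open>i + 2\<close>. A triple of partitions is a
  function \<open>\<mu> :: 3 \<Rightarrow> nat list\<close>. The three cylinders are written out below in
  \<open>cyl_1\<close>, \<open>cyl_2\<close>, \<open>cyl_3\<close>.
\<close>

definition cyl :: "(3 \<Rightarrow> nat list) \<Rightarrow> 3 \<Rightarrow> cell set" where
  "cyl \<mu> i = {w. (w $ (i + 1), w $ (i + 2)) \<in> young_diagram (\<mu> i)}"

lemma index_mod_3: "(4 :: 3) = 1" "(5 :: 3) = 2"
  by simp_all

lemma vector_3_eta: "vector [w $ 1, w $ 2, w $ 3] = (w :: cell)"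
  by (simp add: vec_eq_iff forall_3)

lemma cyl_1: "cyl \<mu> 1 = {vector [x, u, v] | x u v. (u, v) \<in> young_diagram (\<mu> 1)}"
  unfolding cyl_def by (auto simp: index_mod_3) (metis vector_3_eta)+

lemma cyl_2: "cyl \<mu> 2 = {vector [v, y, u] | v y u. (u, v) \<in> young_diagram (\<mu> 2)}"
  unfolding cyl_def by (auto simp: index_mod_3) (metis vector_3_eta)+

lemma cyl_3: "cyl \<mu> 3 = {vector [u, v, z] | u v z. (u, v) \<in> young_diagram (\<mu> 3)}"
  unfolding cyl_def by (auto simp: index_mod_3) (metis vector_3_eta)+

definition octant :: "cell set" where
  "octant = {w. \<forall>i. 0 \<le> w $ i}"

definition cyl_minus :: "(3 \<Rightarrow> nat list) \<Rightarrow> 3 \<Rightarrow> cell set" where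
  "cyl_minus \<mu> i = cyl \<mu> i - octant"

definition I_minus :: "(3 \<Rightarrow> nat list) \<Rightarrow> cell set" where
  "I_minus \<mu> = (\<Union>i. cyl_minus \<mu> i)"

definition II_bar :: "(3 \<Rightarrow> nat list) \<Rightarrow> 3 \<Rightarrow> cell set" where
  "II_bar \<mu> i = (cyl \<mu> (i + 1) \<inter> cyl \<mu> (i + 2)) - cyl \<mu> i"

definition II :: "(3 \<Rightarrow> nat list) \<Rightarrow> cell set" where
  "II \<mu> = (\<Union>i. II_bar \<mu> i)"

definition III :: "(3 \<Rightarrow> nat list) \<Rightarrow> cell set" where
  "III \<mu> = (\<Inter>i. cyl \<mu> i)"

definition closed_in :: "cell set \<Rightarrow> cell set \<Rightarrow> bool" where
  "closed_in R X \<longleftrightarrow> (\<forall>w\<in>R. (\<exists>i. w - axis i 1 \<in> X) \<longrightarrow> w \<in> X)"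

definition AB_configuration :: "(3 \<Rightarrow> nat list) \<Rightarrow> cell set \<Rightarrow> cell set \<Rightarrow> bool" where
  "AB_configuration \<mu> A B \<longleftrightarrow>
     finite A \<and> finite B \<and> A \<subseteq> I_minus \<mu> \<union> III \<mu> \<and> B \<subseteq> II \<mu> \<union> III \<mu> \<and>
     closed_in (I_minus \<mu> \<union> III \<mu>) A \<and> closed_in (II \<mu> \<union> III \<mu>) B"

definition cell_adjacent :: "cell \<Rightarrow> cell \<Rightarrow> bool" where
  "cell_adjacent w w' \<longleftrightarrow> (\<exists>i. w' = w + axis i 1 \<or> w' = w - axis i 1)"

definition cell_components :: "cell set \<Rightarrow> cell set set" where
  "cell_components S =
     S // ({(w, w'). w \<in> S \<and> w' \<in> S \<and> cell_adjacent w w'}\<^sup>* \<inter> S \<times> S)"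

definition labelled_AB_configuration :: "(3 \<Rightarrow> nat list) \<Rightarrow> cell set \<Rightarrow> cell set \<Rightarrow> bool" where
  "labelled_AB_configuration \<mu> A B \<longleftrightarrow>
     AB_configuration \<mu> A B \<and>
     \<not> (\<exists>C \<in> cell_components
              ((I_minus \<mu> \<inter> A) \<union> (II \<mu> - B) \<union> (III \<mu> \<inter> ((A - B) \<union> (B - A)))).
          \<exists>i j. i \<noteq> j \<and> C \<inter> (cyl_minus \<mu> i \<union> II_bar \<mu> i) \<noteq> {} \<and>
                       C \<inter> (cyl_minus \<mu> j \<union> II_bar \<mu> j) \<noteq> {})"


section \<open>The triangular lattice and the honeycomb graph\<close>

type_synonym plane = "real \<times> real"

text \<open>Linear, surjective, with kernel spanned by \<open>(1, 1, 1)\<close>.\<close>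

definition proj :: "real ^ 3 \<Rightarrow> plane" where
  "proj x = (x $ 1 - x $ 3, x $ 2 - x $ 3)"

definition real_cell :: "cell \<Rightarrow> real ^ 3" where
  "real_cell w = (\<chi> i. real_of_int (w $ i))"

definition lattice_points :: "plane set" where
  "lattice_points = range (\<lambda>w. proj (real_cell w))"

definition lattice_adjacent :: "plane \<Rightarrow> plane \<Rightarrow> bool" where
  "lattice_adjacent P Q \<longleftrightarrow> P \<in> lattice_points \<and> Q \<in> lattice_points \<and>
     (\<exists>i. Q = P + proj (axis i 1) \<or> Q = P - proj (axis i 1))"

definition unit_triangles :: "plane set set" where
  "unit_triangles = {convex hull {P, Q, R} | P Q R.
     lattice_adjacent P Q \<and> lattice_adjacent Q R \<and> lattice_adjacent R P}"

text \<open>The vertices of the honeycomb graph are the members of \<open>unit_triangles\<close>.\<close>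

definition honeycomb_edges :: "plane set set set" where
  "honeycomb_edges = {{s, t} | s t.
     s \<in> unit_triangles \<and> t \<in> unit_triangles \<and> s \<noteq> t \<and>
     (\<exists>P Q. lattice_adjacent P Q \<and> s \<inter> t = closed_segment P Q)}"


section \<open>Lozenge tilings and dimers\<close>

definition solid :: "cell set \<Rightarrow> (real ^ 3) set" where
  "solid U = (\<Union>w\<in>U. cbox (real_cell w) (real_cell w + 1))"

definition unit_square :: "cell \<Rightarrow> 3 \<Rightarrow> (real ^ 3) set" where
  "unit_square w i =
     {x. x $ i = real_of_int (w $ i) \<and>
         (\<forall>j. j \<noteq> i \<longrightarrow> real_of_int (w $ j) \<le> x $ j \<and> x $ j \<le> real_of_int (w $ j) + 1)}"

definition lozenge_tiling :: "cell set \<Rightarrow> plane set set" where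
  "lozenge_tiling U = {proj ` unit_square w i | w i. unit_square w i \<subseteq> frontier (solid U)}"

definition dimers :: "cell set \<Rightarrow> plane set set set" where
  "dimers U = {e \<in> honeycomb_edges. \<Union>e \<in> lozenge_tiling U}"

definition U_A :: "(3 \<Rightarrow> nat list) \<Rightarrow> cell set \<Rightarrow> cell set" where
  "U_A \<mu> A = {w. \<exists>i j. i \<noteq> j \<and> w $ i < 0 \<and> w $ j < 0} \<union> ((I_minus \<mu> \<union> III \<mu>) - A)"

definition U_B :: "(3 \<Rightarrow> nat list) \<Rightarrow> cell set \<Rightarrow> cell set" where
  "U_B \<mu> B = (- octant) \<union> ((II \<mu> \<union> III \<mu>) - B)"

text \<open>The superposition is an infinite multiset of edges, given by its multiplicity function.\<close>

definition double_dimer ::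
  "(3 \<Rightarrow> nat list) \<Rightarrow> cell set \<Rightarrow> cell set \<Rightarrow> plane set set \<Rightarrow> nat" where
  "double_dimer \<mu> A B e = of_bool (e \<in> dimers (U_A \<mu> A)) + of_bool (e \<in> dimers (U_B \<mu> B))"


section \<open>Bi-infinite paths and sectors\<close>

text \<open>
  \<open>f\<close> enumerates, without repetition, the vertices of a connected component that is a bi-infinite
  path: the edges of the configuration that meet the vertices of \<open>f\<close> are exactly the steps of \<open>f\<close>.
\<close>

definition bi_infinite_path :: "(plane set set \<Rightarrow> nat) \<Rightarrow> (int \<Rightarrow> plane set) \<Rightarrow> bool" where
  "bi_infinite_path D f \<longleftrightarrow>
     inj f \<and> {e. D e > 0 \<and> e \<inter> range f \<noteq> {}} = range (\<lambda>n. {f n, f (n + 1)})"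

definition sector :: "3 \<Rightarrow> plane set" where
  "sector i =
     {proj (a *\<^sub>R axis (i + 1) 1 + b *\<^sub>R axis (i + 2) 1) | a b. 0 \<le> a \<and> 0 \<le> b}"

text \<open>
  The bounding rays run along lattice edges, so each unit triangle lies in exactly one sector.
\<close>

definition starts_and_ends_in_same_sector :: "(int \<Rightarrow> plane set) \<Rightarrow> bool" where
  "starts_and_ends_in_same_sector f \<longleftrightarrow>
     (\<exists>i. (\<forall>\<^sub>F n in at_bot. f n \<subseteq> sector i) \<and> (\<forall>\<^sub>F n in at_top. f n \<subseteq> sector i))"

end

theory Submission
  imports Defs
begin

text \<open>
  A down-closed set \<open>U\<close> is encoded by its height function on the lattice points, that is, on the
  lines in direction \<open>(1, 1, 1)\<close>. Crossing a honeycomb edge, the height drops exactly at the dimers,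
  so every node lies on exactly one dimer, and the edges occurring once in a double-dimer
  configuration are those across which the difference (``gap'') of the two heights changes, by one.
  Paths are therefore level curves of the gap.

  Put \<open>V = U\<^sub>B - U\<^sub>A\<close>. It consists of the outer regions \<open>N\<^sub>i\<close> (cells whose only negative coordinate is
  the \<open>i\<close>-th and which lie outside \<open>Cyl\<^sub>i\<close>; they project into sector \<open>i\<close>) and of finitely many further
  cells, and \<open>(A, B)\<close> is labelled iff no two of the \<open>N\<^sub>i\<close> are connected inside \<open>V\<close>. The lower side of a
  bi-infinite path runs through the projection of \<open>V\<close>, and far out it meets only the \<open>N\<^sub>i\<close> of the sector
  the path is in; hence in the labelled case both ends lie in one sector. Conversely, take the path
  that runs out along the ray between sectors \<open>i\<close> and \<open>i + 1\<close> on the side of sector \<open>i\<close>. If it returns to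
  sector \<open>i\<close>, then the gap restricted to this one path is a closed 1-form on the triangular lattice;
  its potential is constant on the connected components of \<open>V\<close> but differs by one between \<open>N\<^sub>i\<close> and
  \<open>N\<^sub>i\<^sub>+\<^sub>1\<close>, so these are not connected. The potential replaces the Jordan curve theorem.
\<close>

subsection \<open>Combinatorial coordinates for the honeycomb graph\<close>

text \<open>The integer form of \<open>proj\<close> on the standard basis. The sum of the three
  basis vectors spans the kernel, so the three steps add up to 0.\<close>

definition step :: "3 \<Rightarrow> int \<times> int" where
  "step i = (if i = 1 then (1, 0) else if i = 2 then (0, 1) else (-1, -1))"

definition line :: "cell \<Rightarrow> int \<times> int" where
  "line w = (w $ 1 - w $ 3, w $ 2 - w $ 3)"

text \<open>
  The nodes \<open>(False, a, b)\<close> and \<open>(True, a, b)\<close> are the two triangles of the unit square with lower left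
  corner \<open>(a, b)\<close>. The honeycomb edge with index \<open>i\<close> at a node separates the lattice points \<open>tail\<close> and
  \<open>head\<close>, which differ by \<open>step i\<close>, and leads to the node \<open>nb\<close>.
\<close>

type_synonym node = "bool \<times> int \<times> int"

fun head :: "node \<Rightarrow> 3 \<Rightarrow> int \<times> int" where
  "head (False, a, b) i = (if i = 1 then (a + 1, b) else if i = 2 then (a + 1, b + 1) else (a, b))"
| "head (True, a, b) i = (if i = 1 then (a + 1, b + 1) else if i = 2 then (a, b + 1) else (a, b))"

definition tail :: "node \<Rightarrow> 3 \<Rightarrow> int \<times> int" where
  "tail s i = head s i - step i"

fun nb :: "node \<Rightarrow> 3 \<Rightarrow> node" where
  "nb (False, a, b) i = (True, if i = 1 then (a, b - 1) else if i = 2 then (a + 1, b) else (a, b))"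
| "nb (True, a, b) i = (False, if i = 1 then (a, b + 1) else if i = 2 then (a - 1, b) else (a, b))"

text \<open>Inverse to \<open>head\<close> for a fixed orientation of the triangle and a fixed edge
  index, so that a honeycomb edge can be addressed by its index and one lattice point.\<close>

fun node_at :: "bool \<Rightarrow> 3 \<Rightarrow> int \<times> int \<Rightarrow> node" where
  "node_at False i (a, b) = (False, if i = 1 then (a - 1, b) else if i = 2 then (a - 1, b - 1) else (a, b))"
| "node_at True i (a, b) = (True, if i = 1 then (a - 1, b - 1) else if i = 2 then (a, b - 1) else (a, b))"

fun tri :: "node \<Rightarrow> plane set" where
  "tri (False, a, b) = {(x, y). x \<le> a + 1 \<and> b \<le> y \<and> y - b \<le> x - a}"
| "tri (True, a, b) = {(x, y). a \<le> x \<and> y \<le> b + 1 \<and> x - a \<le> y - b}"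

definition real_pt :: "int \<times> int \<Rightarrow> plane" where
  "real_pt P = (real_of_int (fst P), real_of_int (snd P))"

lemma index_distinct [simp]: "(1::3) \<noteq> 2" "(2::3) \<noteq> 1" "(1::3) \<noteq> 3" "(3::3) \<noteq> 1" "(2::3) \<noteq> 3" "(3::3) \<noteq> 2"
  by simp_all

lemma index_cases: obtains "i = (1::3)" | "i = 2" | "i = 3"
  using exhaust_3 by blast

lemma ex_3_index: "(\<exists>i::3. P i) \<longleftrightarrow> P 1 \<or> P 2 \<or> P 3"
  by (metis exhaust_3)

lemma node_cases: obtains a b where "s = (False, a, b)" | a b where "s = (True, a, b)"
  by (cases s) auto

lemma nb_nb [simp]: "nb (nb s i) i = s"
  by (cases s rule: node_cases; cases i rule: index_cases) auto

lemma head_nb [simp]: "head (nb s i) i = head s i"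
  by (cases s rule: node_cases; cases i rule: index_cases) auto

lemma tail_nb [simp]: "tail (nb s i) i = tail s i"
  by (simp add: tail_def)

lemma fst_nb [simp]: "fst (nb s i) = (\<not> fst s)"
  by (cases s rule: node_cases) auto

lemma head_node_at [simp]: "head (node_at c i P) i = P"
  by (cases P; cases c; cases i rule: index_cases) auto

lemma node_at_head [simp]: "node_at (fst s) i (head s i) = s"
  by (cases s rule: node_cases; cases i rule: index_cases) auto

lemma fst_node_at [simp]: "fst (node_at c i P) = c"
  by (cases P; cases c) auto

lemma nb_node_at [simp]: "nb (node_at c i P) i = node_at (\<not> c) i P"
  by (cases P; cases c; cases i rule: index_cases) auto

lemma line_add_axis [simp]: "line (w + axis i 1) = line w + step i"
  by (cases i rule: index_cases) (auto simp: line_def step_def axis_def)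

lemma line_diff_axis [simp]: "line (w - axis i 1) = line w - step i"
  by (cases i rule: index_cases) (auto simp: line_def step_def axis_def)

lemma proj_real_cell: "proj (real_cell w) = real_pt (line w)"
  by (simp add: proj_def real_cell_def real_pt_def line_def)

lemma proj_axis: "proj (axis i 1) = real_pt (step i)"
  by (cases i rule: index_cases) (auto simp: proj_def axis_def real_pt_def step_def)

lemma line_surj: "\<exists>w. line w = P"
proof -
  have "line (vector [fst P, snd P, 0]) = P" by (simp add: line_def)
  then show ?thesis by blast
qed

section \<open>Unit triangles in integer coordinates\<close>

lemma lattice_points_eq: "lattice_points = range real_pt"
  unfolding lattice_points_def proj_real_cell using line_surj by (auto simp: image_iff) (metis)

lemma real_pt_inj: "real_pt P = real_pt Q \<longleftrightarrow> P = Q"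
  by (auto simp: real_pt_def prod_eq_iff)

lemma real_pt_add: "real_pt (P + Q) = real_pt P + real_pt Q"
  and real_pt_diff: "real_pt (P - Q) = real_pt P - real_pt Q"
  by (auto simp: real_pt_def)

lemma lattice_adjacent_iff:
  "lattice_adjacent X Y \<longleftrightarrow> (\<exists>P Q i. X = real_pt P \<and> Y = real_pt Q \<and> (Q = P + step i \<or> Q = P - step i))"
  unfolding lattice_adjacent_def lattice_points_eq proj_axis
  by (auto simp flip: real_pt_add real_pt_diff simp: real_pt_inj simp del: split_paired_Ex)

lemma convex_hull_node:
  "convex hull {real_pt (head s 1), real_pt (head s 2), real_pt (head s 3)} = tri s"
proof (cases s rule: node_cases)
  case (1 a b)
  show ?thesis
  proof (intro equalityI subsetI)
    fix z assume "z \<in> convex hull {real_pt (head s 1), real_pt (head s 2), real_pt (head s 3)}"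
    then obtain u v w where "u \<ge> 0" "v \<ge> 0" "w \<ge> 0" "u + v + w = 1"
      "z = u *\<^sub>R real_pt (head s 1) + v *\<^sub>R real_pt (head s 2) + w *\<^sub>R real_pt (head s 3)"
      unfolding convex_hull_3 by blast
    moreover from this have "w = 1 - u - v" by simp
    ultimately show "z \<in> tri s" by (simp add: 1 real_pt_def algebra_simps)
  next
    fix z assume z: "z \<in> tri s"
    obtain x y where xy: "z = (x, y)" by (cases z)
    \<comment> \<open>The coefficients are the barycentric coordinates of \<open>z\<close>.\<close>
    have "z = (x - a - (y - b)) *\<^sub>R real_pt (head s 1) + (y - b) *\<^sub>R real_pt (head s 2)
        + (a + 1 - x) *\<^sub>R real_pt (head s 3)"
      by (simp add: 1 real_pt_def xy algebra_simps)
    then show "z \<in> convex hull {real_pt (head s 1), real_pt (head s 2), real_pt (head s 3)}"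
      unfolding convex_hull_3 using z
      by (intro CollectI exI[of _ "x - a - (y - b)"] exI[of _ "y - b"] exI[of _ "a + 1 - x"]) (auto simp: 1 xy)
  qed
next
  case (2 a b)
  show ?thesis
  proof (intro equalityI subsetI)
    fix z assume "z \<in> convex hull {real_pt (head s 1), real_pt (head s 2), real_pt (head s 3)}"
    then obtain u v w where "u \<ge> 0" "v \<ge> 0" "w \<ge> 0" "u + v + w = 1"
      "z = u *\<^sub>R real_pt (head s 1) + v *\<^sub>R real_pt (head s 2) + w *\<^sub>R real_pt (head s 3)"
      unfolding convex_hull_3 by blast
    moreover from this have "w = 1 - u - v" by simp
    ultimately show "z \<in> tri s" by (simp add: 2 real_pt_def algebra_simps)
  next
    fix z assume z: "z \<in> tri s"
    obtain x y where xy: "z = (x, y)" by (cases z)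
    have "z = (x - a) *\<^sub>R real_pt (head s 1) + (y - b - (x - a)) *\<^sub>R real_pt (head s 2)
        + (b + 1 - y) *\<^sub>R real_pt (head s 3)"
      by (simp add: 2 real_pt_def xy algebra_simps)
    then show "z \<in> convex hull {real_pt (head s 1), real_pt (head s 2), real_pt (head s 3)}"
      unfolding convex_hull_3 using z
      by (intro CollectI exI[of _ "x - a"] exI[of _ "y - b - (x - a)"] exI[of _ "b + 1 - y"]) (auto simp: 2 xy)
  qed
qed

lemma head_in_tri: "real_pt (head s i) \<in> tri s"
  by (cases s rule: node_cases; cases i rule: index_cases) (auto simp: real_pt_def)

lemma lattice_triangle_is_node:
  assumes "Q - P \<in> {(1, 0), (0, 1), (-1, -1), (-1, 0), (0, -1), (1, 1)}"
    "R - Q \<in> {(1, 0), (0, 1), (-1, -1), (-1, 0), (0, -1), (1, 1)}"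
    "P - R \<in> {(1, 0), (0, 1), (-1, -1), (-1, 0), (0, -1), (1, 1)}"
  shows "\<exists>s. {P, Q, R} = {head s 1, head s 2, head s 3}"
proof -
  define S :: "(int \<times> int) set" where "S = {(1, 0), (0, 1), (-1, -1), (-1, 0), (0, -1), (1, 1)}"
  obtain a b c d e f where P: "P = (a, b)" "Q = (a + c, b + d)" "R = (a + c + e, b + d + f)"
  proof -
    have "P = (fst P, snd P)" "Q = (fst P + (fst Q - fst P), snd P + (snd Q - snd P))"
      "R = (fst P + (fst Q - fst P) + (fst R - fst Q), snd P + (snd Q - snd P) + (snd R - snd Q))"
      by (simp_all add: prod_eq_iff)
    then show thesis by (rule that)
  qed
  \<comment> \<open>Three lattice directions adding up to 0: the six triangles around
    \<open>P\<close>, each traversed in two ways.\<close>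
  have *: "\<forall>(c, d)\<in>S. \<forall>(e, f)\<in>S. (- c - e, - d - f) \<in> S \<longrightarrow>
     (c, d, e, f) \<in> {(1, 0, 0, 1), (0, 1, -1, -1), (-1, -1, 1, 0), (0, 1, 1, 0), (1, 0, -1, -1), (-1, -1, 0, 1),
      (-1, 0, 0, -1), (0, -1, 1, 1), (1, 1, -1, 0), (0, -1, -1, 0), (-1, 0, 1, 1), (1, 1, 0, -1)}"
    by (simp add: S_def)
  have "(c, d) \<in> S" "(e, f) \<in> S" "(- c - e, - d - f) \<in> S"
    using assms by (simp_all add: P flip: S_def)
  with * have cdef: "(c, d, e, f) \<in> {(1, 0, 0, 1), (0, 1, -1, -1), (-1, -1, 1, 0), (0, 1, 1, 0), (1, 0, -1, -1), (-1, -1, 0, 1),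
      (-1, 0, 0, -1), (0, -1, 1, 1), (1, 1, -1, 0), (0, -1, -1, 0), (-1, 0, 1, 1), (1, 1, 0, -1)}"
    unfolding Ball_def split_paired_All prod.case by metis
  let ?T = "\<lambda>s. {P, Q, R} = {head s 1, head s 2, head s 3}"
  from cdef have "?T (False, a, b) \<or> ?T (False, a - 1, b) \<or> ?T (False, a - 1, b - 1) \<or>
      ?T (True, a, b) \<or> ?T (True, a, b - 1) \<or> ?T (True, a - 1, b - 1)"
    unfolding P by (elim insertE emptyE) (simp_all add: insert_commute)
  then show ?thesis by blast
qed

lemma unit_triangles_eq: "unit_triangles = range tri"
proof (intro equalityI subsetI)
  fix t assume "t \<in> unit_triangles"
  then obtain X Y Z where t: "t = convex hull {X, Y, Z}"
    "lattice_adjacent X Y" "lattice_adjacent Y Z" "lattice_adjacent Z X"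
    unfolding unit_triangles_def by blast
  then obtain P Q R where pts: "X = real_pt P" "Y = real_pt Q" "Z = real_pt R"
    unfolding lattice_adjacent_iff by blast
  have "Y' - X' \<in> {(1, 0), (0, 1), (-1, -1), (-1, 0), (0, -1), (1, 1)}"
    if "lattice_adjacent (real_pt X') (real_pt Y')" for X' Y'
    using that unfolding lattice_adjacent_iff real_pt_inj by (auto simp: ex_3_index step_def)
  then obtain s where "{P, Q, R} = {head s 1, head s 2, head s 3}"
    using lattice_triangle_is_node t(2-4) unfolding pts by metis
  then have "real_pt ` {P, Q, R} = real_pt ` {head s 1, head s 2, head s 3}" by simp
  then have "t = tri s" unfolding t(1) pts by (simp flip: convex_hull_node)
  then show "t \<in> range tri" by simp
next
  fix t assume "t \<in> range tri"
  then obtain s where s: "t = tri s" by blast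
  have adj: "lattice_adjacent (real_pt P) (real_pt Q) \<longleftrightarrow>
      Q - P \<in> {step 1, step 2, step 3, - step 1, - step 2, - step 3}" for P Q
    unfolding lattice_adjacent_iff real_pt_inj by (auto simp: ex_3_index diff_eq_eq eq_diff_eq simp del: split_paired_Ex)
  have "lattice_adjacent (real_pt (head s 1)) (real_pt (head s 2))"
    "lattice_adjacent (real_pt (head s 2)) (real_pt (head s 3))"
    "lattice_adjacent (real_pt (head s 3)) (real_pt (head s 1))"
    by (cases s rule: node_cases; simp add: adj step_def)+
  then show "t \<in> unit_triangles"
    unfolding s unit_triangles_def convex_hull_node[symmetric] by blast
qed

fun centroid :: "node \<Rightarrow> plane" where
  "centroid (False, a, b) = (a + 2/3, b + 1/3)"
| "centroid (True, a, b) = (a + 1/3, b + 2/3)"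

text \<open>Centroids are interior points and tell the triangles apart. This later recovers the
  nodes from a triangle or a lozenge that is given only as a point set.\<close>

lemma centroid_in_tri: "centroid s \<in> tri t \<longleftrightarrow> s = t"
proof -
  \<comment> \<open>A fractional slack below 1 disappears between integers, so the real inequalities
    become integral ones.\<close>
  have le: "real_of_int x \<le> real_of_int y + c \<longleftrightarrow> x \<le> y" if "0 \<le> c" "c < 1" for x y c
    using that by linarith
  show ?thesis
  proof
    assume h: "centroid s \<in> tri t"
    show "s = t"
    proof (cases s rule: node_cases; cases t rule: node_cases)
      fix a b a' b' assume st: "s = (False, a, b)" "t = (False, a', b')"
      have "real_of_int a \<le> a' + 1/3" "real_of_int b' \<le> b + 1/3" "real_of_int (b - b') \<le> real_of_int (a - a') + 1/3"
        using h by (simp_all add: st)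
      then show ?thesis unfolding st by (subst (asm) (1 2 3) le) simp_all
    next
      fix a b a' b' assume st: "s = (True, a, b)" "t = (True, a', b')"
      have "real_of_int a' \<le> a + 1/3" "real_of_int b \<le> b' + 1/3" "real_of_int (a - a') \<le> real_of_int (b - b') + 1/3"
        using h by (simp_all add: st)
      then show ?thesis unfolding st by (subst (asm) (1 2 3) le) simp_all
    next
      fix a b a' b' assume st: "s = (False, a, b)" "t = (True, a', b')"
      have "real_of_int a' \<le> a + 2/3" "real_of_int b \<le> b' + 2/3" "real_of_int (a - a' + 1) \<le> real_of_int (b - b') + 2/3"
        using h by (simp_all add: st)
      then show ?thesis unfolding st by (subst (asm) (1 2 3) le) simp_all
    next
      fix a b a' b' assume st: "s = (True, a, b)" "t = (False, a', b')"
      have "real_of_int a \<le> a' + 2/3" "real_of_int b' \<le> b + 2/3" "real_of_int (b - b' + 1) \<le> real_of_int (a - a') + 2/3"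
        using h by (simp_all add: st)
      then show ?thesis unfolding st by (subst (asm) (1 2 3) le) simp_all
    qed
  next
    assume "s = t"
    then show "centroid s \<in> tri t" by (cases t rule: node_cases) auto
  qed
qed

lemma tri_inj [simp]: "tri s = tri t \<longleftrightarrow> s = t"
  using centroid_in_tri by metis

lemma tri_subset_Un: "tri s \<subseteq> tri t \<union> tri t' \<Longrightarrow> s = t \<or> s = t'"
  using centroid_in_tri by blast

lemma tri_Un_inj:
  assumes "tri s \<union> tri s' = tri t \<union> tri t'" "s \<noteq> s'"
  shows "{s, s'} = {t, t'}"
proof -
  have "s \<in> {t, t'}" "s' \<in> {t, t'}" using tri_subset_Un assms(1) by blast+
  then show ?thesis using assms(2) by blast
qed

lemma edge_segment:
  "tri s \<inter> tri (nb s i) = closed_segment (real_pt (tail s i)) (real_pt (head s i))"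
proof -
  have *: "tri s \<inter> tri (nb s i) = closed_segment (real_pt (tail s i)) (real_pt (head s i))" if "\<not> fst s" for s
  proof -
    obtain a b where s: "s = (False, a, b)" using \<open>\<not> fst s\<close> by (cases s rule: node_cases) auto
    show ?thesis
    proof (intro equalityI subsetI)
      fix z assume z: "z \<in> tri s \<inter> tri (nb s i)"
      obtain x y where xy: "z = (x, y)" by (cases z)
      \<comment> \<open>The position along the shared edge, read off from a coordinate that changes
        at unit speed from \<open>tail\<close> to \<open>head\<close>.\<close>
      let ?u = "if i = 1 then x - a else if i = 2 then y - b else a + 1 - x"
      have "z = (1 - ?u) *\<^sub>R real_pt (tail s i) + ?u *\<^sub>R real_pt (head s i)" "0 \<le> ?u" "?u \<le> 1"
        using z by (cases i rule: index_cases; auto simp: xy s tail_def step_def real_pt_def algebra_simps)+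
      then show "z \<in> closed_segment (real_pt (tail s i)) (real_pt (head s i))"
        unfolding closed_segment_def by blast
    next
      fix z assume "z \<in> closed_segment (real_pt (tail s i)) (real_pt (head s i))"
      then obtain u where "0 \<le> u" "u \<le> 1" "z = (1 - u) *\<^sub>R real_pt (tail s i) + u *\<^sub>R real_pt (head s i)"
        unfolding closed_segment_def by blast
      then show "z \<in> tri s \<inter> tri (nb s i)"
        by (cases i rule: index_cases; simp add: s tail_def step_def real_pt_def algebra_simps)
    qed
  qed
  show ?thesis
  proof (cases "fst s")
    case True
    then show ?thesis using *[of "nb s i"] by (simp add: Int_commute)
  qed (rule *)
qed

lemma lattice_adjacent_tail_head: "lattice_adjacent (real_pt (tail s i)) (real_pt (head s i))"
  unfolding lattice_adjacent_iff
  by (rule exI[of _ "tail s i"], rule exI[of _ "head s i"], rule exI[of _ i]) (simp add: tail_def)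

lemma honeycomb_edge: "{tri s, tri (nb s i)} \<in> honeycomb_edges"
proof -
  have "nb s i \<noteq> s" by (metis fst_nb)
  then have "tri s \<noteq> tri (nb s i)" by simp
  then show ?thesis
    unfolding honeycomb_edges_def unit_triangles_eq
    using lattice_adjacent_tail_head[of s i] edge_segment[of s i] by blast
qed

text \<open>The diagonal of the square that starts at \<open>w\<close> projects to the lattice edge
  between \<open>head s i\<close> and \<open>tail s i\<close>, because the two other steps add up to
  \<open>- step i\<close>. The halves of the square become the triangles on both sides of that
  edge.\<close>

lemma lozenge_eq:
  assumes "head s i = line w"
  shows "proj ` unit_square w i = tri s \<union> tri (nb s i)"
proof -
  have s: "s = node_at (fst s) i (line w)" "nb s i = node_at (\<not> fst s) i (line w)"
    using node_at_head[of s i] node_at_head[of "nb s i" i] assms by simp_all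
  have "proj ` unit_square w i = tri (node_at False i (line w)) \<union> tri (node_at True i (line w))"
  proof (intro equalityI subsetI)
    fix z assume "z \<in> proj ` unit_square w i"
    then show "z \<in> tri (node_at False i (line w)) \<union> tri (node_at True i (line w))"
      by (cases i rule: index_cases) (auto simp: unit_square_def proj_def line_def forall_3)
  next
    fix z assume z: "z \<in> tri (node_at False i (line w)) \<union> tri (node_at True i (line w))"
    obtain x y where xy: "z = (x, y)" by (cases z)
    \<comment> \<open>The shift along (1, 1, 1) that lifts \<open>z\<close> into the plane of the
      square.\<close>
    let ?c = "if i = 1 then w $ 1 - x else if i = 2 then w $ 2 - y else w $ 3"
    have "vector [x + ?c, y + ?c, ?c] \<in> unit_square w i"
      using z by (cases i rule: index_cases) (auto simp: unit_square_def xy line_def forall_3)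
    moreover have "proj (vector [x + ?c, y + ?c, ?c]) = z"
      by (simp add: proj_def xy)
    ultimately show "z \<in> proj ` unit_square w i" by (metis image_eqI)
  qed
  then show ?thesis by (subst s(1), subst s(2), cases "fst s") auto
qed

subsection \<open>Lozenges on the surface of a down-closed set\<close>

definition down_closed :: "cell set \<Rightarrow> bool" where
  "down_closed U \<longleftrightarrow> (\<forall>w\<in>U. \<forall>w'. (\<forall>j. w' $ j \<le> w $ j) \<longrightarrow> w' \<in> U)"

lemma down_closedD: "down_closed U \<Longrightarrow> w \<in> U \<Longrightarrow> (\<And>j. w' $ j \<le> w $ j) \<Longrightarrow> w' \<in> U"
  unfolding down_closed_def by blast

lemma mem_solid: "x \<in> solid U \<longleftrightarrow> (\<exists>w\<in>U. \<forall>j. w $ j \<le> x $ j \<and> x $ j \<le> w $ j + 1)"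
  by (simp add: solid_def mem_box_cart real_cell_def)

text \<open>Domination is the key: a cell of \<open>U\<close> containing a suitable point near the
  square is coordinatewise at least \<open>w\<close> or \<open>w - axis i 1\<close>, which therefore
  lies in \<open>U\<close> as well.\<close>

lemma unit_square_frontier:
  assumes U: "down_closed U"
  shows "unit_square w i \<subseteq> frontier (solid U) \<longleftrightarrow> w - axis i 1 \<in> U \<and> w \<notin> U"
proof
  assume "w - axis i 1 \<in> U \<and> w \<notin> U"
  then have v: "w - axis i 1 \<in> U" and w: "w \<notin> U" by auto
  show "unit_square w i \<subseteq> frontier (solid U)"
  proof
    fix x assume x: "x \<in> unit_square w i"
    have "x \<in> solid U"
      unfolding mem_solid using v x by (intro bexI[of _ "w - axis i 1"]) (auto simp: unit_square_def axis_def)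
    then have "x \<in> closure (solid U)" using closure_subset by blast
    moreover have "x \<notin> interior (solid U)"
    proof
      assume "x \<in> interior (solid U)"
      then obtain e where e: "e > 0" "ball x e \<subseteq> solid U" unfolding mem_interior by blast
      \<comment> \<open>Moving up by \<open>e / 4\<close> in all three coordinates stays inside the
        ball, and every cell that contains the new point dominates \<open>w\<close>.\<close>
      define y where "y = (\<chi> j. x $ j + e / 4)"
      have "norm (y - x) \<le> (\<Sum>j\<in>UNIV. \<bar>(y - x) $ j\<bar>)" by (rule norm_le_l1_cart)
      also have "\<dots> < e" using e(1) by (simp add: y_def sum_3)
      finally have "y \<in> ball x e" by (simp add: dist_norm norm_minus_commute)
      then obtain w' where w': "w' \<in> U" "\<And>j. y $ j \<le> w' $ j + 1"
        using e(2) unfolding subset_iff mem_solid by blast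
      have "w $ j \<le> w' $ j" for j
      proof -
        have "real_of_int (w $ j) \<le> x $ j" using x by (cases "j = i") (auto simp: unit_square_def)
        then have "real_of_int (w $ j) < w' $ j + 1" using w'(2)[of j] e(1) by (simp add: y_def)
        then show ?thesis by linarith
      qed
      then show False using down_closedD[OF U w'(1)] w by blast
    qed
    ultimately show "x \<in> frontier (solid U)" by (simp add: frontier_def)
  qed
next
  assume h: "unit_square w i \<subseteq> frontier (solid U)"
  \<comment> \<open>The centre of the square: the ball of radius 1/2 around it is covered by the two
    cells that share the square.\<close>
  define x where "x = (\<chi> j. if j = i then real_of_int (w $ j) else w $ j + 1/2)"
  have "x \<in> unit_square w i" by (simp add: unit_square_def x_def)
  with h have x: "x \<in> closure (solid U)" "x \<notin> interior (solid U)" by (auto simp: frontier_def)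
  have close: "\<bar>y $ j - x $ j\<bar> < e" if "dist y x < e" for y j e
    using that component_le_norm_cart[of "y - x" j] by (simp add: dist_norm)
  have v: "w - axis i 1 \<in> U"
  proof -
    obtain y where y: "y \<in> solid U" "dist y x < 1/4"
      using x(1) unfolding closure_approachable by (metis zero_less_divide_1_iff zero_less_numeral)
    then obtain w' where w': "w' \<in> U" "\<And>j. y $ j \<le> w' $ j + 1" unfolding mem_solid by blast
    have "(w - axis i 1) $ j \<le> w' $ j" for j
    proof -
      have "x $ j - 1/4 < w' $ j + 1" using close[OF y(2), of j] w'(2)[of j] by linarith
      moreover have "x $ j = (w - axis i 1) $ j + (if j = i then 1 else 1/2)"
        by (simp add: x_def axis_def)
      ultimately have "(w - axis i 1) $ j + real_of_int 0 < w' $ j + 1" by (simp split: if_splits)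
      then show ?thesis by linarith
    qed
    then show ?thesis using down_closedD[OF U w'(1)] by blast
  qed
  moreover have "w \<notin> U"
  proof
    assume w: "w \<in> U"
    have "ball x (1/2) \<subseteq> solid U"
    proof
      fix y assume "y \<in> ball x (1/2)"
      then have y: "\<bar>y $ j - x $ j\<bar> < 1/2" for j using close[of y "1/2" j] by (simp add: dist_commute)
      let ?w = "if y $ i \<ge> w $ i then w else w - axis i 1"
      have "?w $ j \<le> y $ j \<and> y $ j \<le> ?w $ j + 1" for j
        using y[of j] by (cases "j = i") (auto simp: x_def axis_def abs_if split: if_splits)
      then show "y \<in> solid U" unfolding mem_solid using v w by (intro bexI[of _ ?w]) auto
    qed
    then have "x \<in> interior (solid U)" unfolding mem_interior by (metis zero_less_divide_1_iff zero_less_numeral)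
    with x show False by simp
  qed
  ultimately show "w - axis i 1 \<in> U \<and> w \<notin> U" by blast
qed

subsection \<open>Height functions and dimers\<close>

text \<open>Lines in direction (1, 1, 1) are parametrised by the third coordinate. This asymmetric
  choice causes the terms \<open>of_bool (i = 3)\<close> below.\<close>

definition cell_at :: "int \<times> int \<Rightarrow> int \<Rightarrow> cell" where
  "cell_at P t = vector [fst P + t, snd P + t, t]"

definition surface :: "cell set \<Rightarrow> bool" where
  "surface U \<longleftrightarrow> down_closed U \<and> (\<forall>P. (\<exists>t. cell_at P t \<in> U) \<and> (\<exists>t. cell_at P t \<notin> U))"

definition height :: "cell set \<Rightarrow> int \<times> int \<Rightarrow> int" where
  "height U P = (THE h. \<forall>t. cell_at P t \<in> U \<longleftrightarrow> t < h)"

text \<open>Along \<open>step i\<close> the height of a surface changes by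
  \<open>of_bool (i = 3)\<close> or by one less (\<open>height_step\<close>). A drop is the second
  case and marks a dimer across this edge.\<close>

definition drops :: "cell set \<Rightarrow> node \<Rightarrow> 3 \<Rightarrow> bool" where
  "drops U s i \<longleftrightarrow> height U (head s i) - height U (tail s i) = of_bool (i = 3) - 1"

definition dir :: "cell set \<Rightarrow> node \<Rightarrow> 3" where
  "dir U s = (THE i. drops U s i)"

lemma cell_at_nth [simp]: "cell_at P t $ 1 = fst P + t" "cell_at P t $ 2 = snd P + t" "cell_at P t $ 3 = t"
  by (simp_all add: cell_at_def)

lemma line_cell_at [simp]: "line (cell_at P t) = P"
  by (simp add: line_def)

lemma cell_at_line [simp]: "cell_at (line w) (w $ 3) = w"
  by (simp add: line_def vec_eq_iff forall_3)

lemma cell_at_mono: "t \<le> t' \<Longrightarrow> cell_at P t $ j \<le> cell_at P t' $ j"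
  by (cases j rule: index_cases) auto

lemma cell_at_step: "cell_at (P + step i) (t + of_bool (i = 3)) = cell_at P t + axis i 1"
  by (cases i rule: index_cases) (auto simp: vec_eq_iff forall_3 axis_def step_def)

lemma surface_down: "surface U \<Longrightarrow> w \<in> U \<Longrightarrow> (\<And>j. w' $ j \<le> w $ j) \<Longrightarrow> w' \<in> U"
  unfolding surface_def using down_closedD by blast

text \<open>Down-closedness makes \<open>U\<close> an initial ray of every line, and
  \<open>surface\<close> makes it nonempty and proper; so the description in \<open>height\<close>
  determines a number.\<close>

lemma cell_at_in_iff:
  assumes "surface U"
  shows "cell_at P t \<in> U \<longleftrightarrow> t < height U P"
proof -
  obtain a b where a: "cell_at P a \<in> U" and b: "cell_at P b \<notin> U"
    using assms unfolding surface_def by blast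
  have down: "cell_at P t' \<in> U" if "cell_at P t \<in> U" "t' \<le> t" for t t'
    using surface_down[OF assms that(1)] cell_at_mono[OF that(2)] by blast
  define n where "n = (LEAST n. cell_at P (a + int n) \<notin> U)"
  have "b > a" using a b down by (meson not_le)
  then have "cell_at P (a + int (nat (b - a))) \<notin> U" using b by simp
  then have n: "cell_at P (a + int n) \<notin> U" unfolding n_def by (rule LeastI)
  have *: "cell_at P t \<in> U \<longleftrightarrow> t < a + int n" for t
  proof
    assume "t < a + int n"
    show "cell_at P t \<in> U"
    proof (cases "t \<le> a")
      case False
      then have "nat (t - a) < n" using \<open>t < a + int n\<close> by linarith
      then have "cell_at P (a + int (nat (t - a))) \<in> U" unfolding n_def using not_less_Least by blast
      then show ?thesis using False by simp
    qed (use a down in blast)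
  qed (use n down in \<open>meson not_le\<close>)
  have "height U P = a + int n"
    unfolding height_def
  proof (rule the_equality)
    fix h assume "\<forall>t. cell_at P t \<in> U \<longleftrightarrow> t < h"
    then have "t < h \<longleftrightarrow> t < a + int n" for t using * by blast
    then show "h = a + int n" by (meson linorder_neqE less_irrefl)
  qed (use * in blast)
  then show ?thesis using * by simp
qed

lemma in_surface_iff: "surface U \<Longrightarrow> w \<in> U \<longleftrightarrow> w $ 3 < height U (line w)"
  using cell_at_in_iff[of U "line w" "w $ 3"] by simp

text \<open>Both bounds come from down-closedness: if \<open>w + axis i 1\<close> is in
  \<open>U\<close>, then so is \<open>w\<close>; and a cell lowered by (1, 1, 1) and raised by one
  unit vector is dominated by the original cell.\<close>

lemma height_step:
  assumes "surface U"
  shows "height U (P + step i) - height U P \<in> {of_bool (i = 3) - 1, of_bool (i = 3)}"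
proof -
  let ?k = "of_bool (i = 3) :: int"
  have *: "t + ?k < height U (P + step i) \<longleftrightarrow> cell_at P t + axis i 1 \<in> U" for t
    using cell_at_in_iff[OF assms, of "P + step i" "t + ?k"] by (simp add: cell_at_step)
  have "\<not> height U P + ?k < height U (P + step i)"
  proof
    assume "height U P + ?k < height U (P + step i)"
    then have "cell_at P (height U P) + axis i 1 \<in> U" using * by blast
    then have "cell_at P (height U P) \<in> U" by (rule surface_down[OF assms]) (simp add: axis_def)
    then show False by (simp add: cell_at_in_iff[OF assms])
  qed
  moreover have "height U P - 2 + ?k < height U (P + step i)"
  proof -
    have "cell_at P (height U P - 1) \<in> U" by (simp add: cell_at_in_iff[OF assms])
    moreover have "(cell_at P (height U P - 2) + axis i 1) $ j \<le> cell_at P (height U P - 1) $ j" for j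
      by (cases j rule: index_cases) (auto simp: axis_def)
    ultimately have "cell_at P (height U P - 2) + axis i 1 \<in> U" using surface_down[OF assms] by blast
    then show ?thesis using * by blast
  qed
  ultimately show ?thesis by auto
qed

lemma head_eq: "head s i = tail s i + step i"
  by (simp add: tail_def)

lemma height_diff:
  "surface U \<Longrightarrow> height U (head s i) - height U (tail s i) = of_bool (i = 3) - of_bool (drops U s i)"
  using height_step[of U "tail s i" i] by (auto simp: drops_def head_eq)

text \<open>This translates the condition of \<open>unit_square_frontier\<close> into heights. If
  the height drops, the lowest cell outside \<open>U\<close> over \<open>head s i\<close> is the
  witness.\<close>

lemma drops_iff:
  assumes "surface U"
  shows "drops U s i \<longleftrightarrow> (\<exists>w. line w = head s i \<and> w - axis i 1 \<in> U \<and> w \<notin> U)"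
proof -
  let ?k = "of_bool (i = 3) :: int"
  have "w - axis i 1 \<in> U \<and> w \<notin> U \<longleftrightarrow> w $ 3 - ?k < height U (tail s i) \<and> \<not> w $ 3 < height U (head s i)"
    if "line w = head s i" for w
  proof -
    have "(w - axis i 1) $ 3 = w $ 3 - ?k" by (simp add: axis_def)
    moreover have "line (w - axis i 1) = tail s i" using that by (simp add: tail_def)
    ultimately show ?thesis using in_surface_iff[OF assms] that by metis
  qed
  then have "(\<exists>w. line w = head s i \<and> w - axis i 1 \<in> U \<and> w \<notin> U) \<longleftrightarrow>
      (\<exists>w. line w = head s i \<and> w $ 3 - ?k < height U (tail s i) \<and> \<not> w $ 3 < height U (head s i))"
    by blast
  also have "\<dots> \<longleftrightarrow> height U (head s i) - ?k < height U (tail s i)"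
  proof
    assume "height U (head s i) - ?k < height U (tail s i)"
    then show "\<exists>w. line w = head s i \<and> w $ 3 - ?k < height U (tail s i) \<and> \<not> w $ 3 < height U (head s i)"
      by (intro exI[of _ "cell_at (head s i) (height U (head s i))"]) simp
  qed linarith
  also have "\<dots> \<longleftrightarrow> drops U s i"
    using height_diff[OF assms, of s i] by (cases "drops U s i") auto
  finally show ?thesis by simp
qed

text \<open>The three directed edges of a triangle form a cycle, so the differences
  telescope.\<close>

lemma sum_around_node: "(\<Sum>i\<in>UNIV. g (head s i) - g (tail s i)) = (0::int)"
  by (cases s rule: node_cases) (simp_all add: sum_3 tail_def step_def)

text \<open>Round the triangle the height differences cancel while the shifts
  \<open>of_bool (i = 3)\<close> contribute 1, so exactly one edge drops: the dimers form a perfect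
  matching.\<close>

lemma ex1_drops:
  assumes "surface U"
  shows "\<exists>!i. drops U s i"
proof -
  have "(\<Sum>i\<in>UNIV. of_bool (i = 3) - of_bool (drops U s i)) = (0::int)"
    using sum_around_node[of "height U" s] by (simp add: height_diff[OF assms])
  then have "of_bool (drops U s 1) + of_bool (drops U s 2) + of_bool (drops U s 3) = (1::int)"
    by (simp add: sum_3)
  then show ?thesis
    using exhaust_3 by (cases "drops U s 1"; cases "drops U s 2"; cases "drops U s 3"; simp) (metis+)
qed

lemma dir_iff: "surface U \<Longrightarrow> dir U s = i \<longleftrightarrow> drops U s i"
  unfolding dir_def using ex1_drops[of U s] by (metis the1_equality)

lemma dir_nb: "surface U \<Longrightarrow> dir U (nb s i) = i \<longleftrightarrow> dir U s = i"
  by (simp add: dir_iff drops_def)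

text \<open>A lozenge determines its two triangles by \<open>tri_Un_inj\<close>, and its square lies
  on the frontier exactly if the height drops across their common edge. From here on the geometric
  definition is replaced by the matching \<open>dir\<close>.\<close>

lemma dimers_eq:
  assumes "surface U"
  shows "dimers U = {{tri s, tri (nb s (dir U s))} | s. True}"
proof (intro equalityI subsetI)
  fix e assume "e \<in> dimers U"
  then have e: "e \<in> honeycomb_edges" "\<Union>e \<in> lozenge_tiling U" by (simp_all add: dimers_def)
  obtain X Y where XY: "e = {X, Y}" "X \<in> range tri" "Y \<in> range tri" "X \<noteq> Y"
    using e(1) unfolding honeycomb_edges_def unit_triangles_eq by blast
  then obtain s t where st: "e = {tri s, tri t}" "s \<noteq> t" by blast
  obtain w i where w: "\<Union>e = proj ` unit_square w i" "unit_square w i \<subseteq> frontier (solid U)"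
    using e(2) unfolding lozenge_tiling_def by blast
  define r where "r = node_at False i (line w)"
  have "tri s \<union> tri t = tri r \<union> tri (nb r i)"
    using w(1) lozenge_eq[of r i w] st(1) by (simp add: r_def)
  then have "{s, t} = {r, nb r i}" using tri_Un_inj st(2) by blast
  then have "tri ` {s, t} = tri ` {r, nb r i}" by simp
  then have "e = {tri r, tri (nb r i)}" using st(1) by simp
  moreover have "dir U r = i"
    using assms w(2) unit_square_frontier[of U w i]
    by (auto simp: dir_iff drops_iff r_def surface_def)
  ultimately show "e \<in> {{tri s, tri (nb s (dir U s))} | s. True}" by blast
next
  fix e assume "e \<in> {{tri s, tri (nb s (dir U s))} | s. True}"
  then obtain s where e: "e = {tri s, tri (nb s (dir U s))}" by blast
  have "drops U s (dir U s)" using dir_iff[OF assms] by blast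
  then obtain w where w: "line w = head s (dir U s)" "w - axis (dir U s) 1 \<in> U" "w \<notin> U"
    using drops_iff[OF assms] by blast
  then have "unit_square w (dir U s) \<subseteq> frontier (solid U)"
    using unit_square_frontier assms unfolding surface_def by blast
  moreover have "\<Union>e = proj ` unit_square w (dir U s)"
    using lozenge_eq[of s "dir U s" w] w(1) by (simp add: e)
  ultimately have "\<Union>e \<in> lozenge_tiling U" unfolding lozenge_tiling_def by blast
  then show "e \<in> dimers U" using honeycomb_edge by (simp add: dimers_def e)
qed

subsection \<open>Sectors\<close>

text \<open>Subtracting the \<open>i\<close>-th coordinate along (1, 1, 1) leaves the two
  coefficients, whose signs decide.\<close>

lemma proj_in_sector: "proj x \<in> sector i \<longleftrightarrow> (\<forall>j. x $ i \<le> x $ j)"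
proof -
  have s: "proj x \<in> sector i \<longleftrightarrow> (\<exists>a b. 0 \<le> a \<and> 0 \<le> b \<and> proj x = proj (a *\<^sub>R axis (i + 1) 1 + b *\<^sub>R axis (i + 2) 1))"
    unfolding sector_def by blast
  show ?thesis unfolding s
  proof
    assume "\<forall>j. x $ i \<le> x $ j"
    then have "0 \<le> x $ (i + 1) - x $ i \<and> 0 \<le> x $ (i + 2) - x $ i \<and>
        proj x = proj ((x $ (i + 1) - x $ i) *\<^sub>R axis (i + 1) 1 + (x $ (i + 2) - x $ i) *\<^sub>R axis (i + 2) 1)"
      by (cases i rule: index_cases) (simp_all add: proj_def axis_def index_mod_3)
    then show "\<exists>a b. 0 \<le> a \<and> 0 \<le> b \<and> proj x = proj (a *\<^sub>R axis (i + 1) 1 + b *\<^sub>R axis (i + 2) 1)"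
      by blast
  next
    assume "\<exists>a b. 0 \<le> a \<and> 0 \<le> b \<and> proj x = proj (a *\<^sub>R axis (i + 1) 1 + b *\<^sub>R axis (i + 2) 1)"
    then show "\<forall>j. x $ i \<le> x $ j"
      by (cases i rule: index_cases) (auto simp: proj_def axis_def forall_3)
  qed
qed

lemma line_in_sector: "real_pt (line w) \<in> sector i \<longleftrightarrow> (\<forall>j. w $ i \<le> w $ j)"
  unfolding proj_real_cell[symmetric] proj_in_sector by (simp add: real_cell_def)

text \<open>The bounding rays run along lattice edges, so comparing the integers \<open>a\<close>,
  \<open>b\<close> and 0 decides for the whole triangle.\<close>

lemma tri_in_some_sector: "\<exists>i. tri s \<subseteq> sector i"
proof -
  have sec: "(x, y) \<in> sector i \<longleftrightarrow> (i = 1 \<and> x \<le> 0 \<and> x \<le> y \<or> i = 2 \<and> y \<le> 0 \<and> y \<le> x \<or> i = 3 \<and> 0 \<le> x \<and> 0 \<le> y)" for x y i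
  proof -
    have "(x, y) = proj (vector [x, y, 0])" by (simp add: proj_def)
    then show ?thesis using proj_in_sector[of "vector [x, y, 0]" i]
      by (cases i rule: index_cases) (auto simp: forall_3)
  qed
  show ?thesis
  proof (cases s rule: node_cases)
    case (1 a b)
    consider "0 \<le> a" "0 \<le> b" | "a \<le> -1" "a + 1 \<le> b" | "b \<le> -1" "b \<le> a" by linarith
    then show ?thesis
    proof cases
      case c: 1
      have "tri s \<subseteq> sector 3" using c(1,2)[THEN of_int_le_iff[THEN iffD2, where 'a1 = real]] by (auto simp: 1 sec)
      then show ?thesis ..
    next
      case c: 2
      have "tri s \<subseteq> sector 1" using c(1,2)[THEN of_int_le_iff[THEN iffD2, where 'a1 = real]] by (auto simp: 1 sec)
      then show ?thesis ..
    next
      case c: 3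
      have "tri s \<subseteq> sector 2" using c(1,2)[THEN of_int_le_iff[THEN iffD2, where 'a1 = real]] by (auto simp: 1 sec)
      then show ?thesis ..
    qed
  next
    case (2 a b)
    consider "0 \<le> a" "0 \<le> b" | "a \<le> -1" "a \<le> b" | "b \<le> -1" "b + 1 \<le> a" by linarith
    then show ?thesis
    proof cases
      case c: 1
      have "tri s \<subseteq> sector 3" using c(1,2)[THEN of_int_le_iff[THEN iffD2, where 'a1 = real]] by (auto simp: 2 sec)
      then show ?thesis ..
    next
      case c: 2
      have "tri s \<subseteq> sector 1" using c(1,2)[THEN of_int_le_iff[THEN iffD2, where 'a1 = real]] by (auto simp: 2 sec)
      then show ?thesis ..
    next
      case c: 3
      have "tri s \<subseteq> sector 2" using c(1,2)[THEN of_int_le_iff[THEN iffD2, where 'a1 = real]] by (auto simp: 2 sec)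
      then show ?thesis ..
    qed
  qed
qed

subsection \<open>The gap between two surfaces\<close>

text \<open>Going round the triangle, \<open>g\<close> falls by one across \<open>u\<close>, rises
  by one across \<open>v\<close> and is constant across the third edge. So it takes two consecutive
  values, the lower one at the head of \<open>u\<close> and at the tail of \<open>v\<close>.\<close>

lemma corner_values:
  fixes g :: "int \<times> int \<Rightarrow> int"
  assumes g: "\<And>i. g (head s i) - g (tail s i) = of_bool (v = i) - of_bool (u = i)" and "u \<noteq> v"
  shows "g (tail s u) = g (head s u) + 1" "g (tail s v) = g (head s u)"
    "g (head s i) \<in> {g (head s u), g (head s u) + 1}" "g (tail s i) \<in> {g (head s u), g (head s u) + 1}"
proof -
  show "g (tail s u) = g (head s u) + 1" using g[of u] \<open>u \<noteq> v\<close> by simp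
  have "g (tail s v) = g (head s u) \<and> g (head s i) \<in> {g (head s u), g (head s u) + 1} \<and>
     g (tail s i) \<in> {g (head s u), g (head s u) + 1}"
    using g[of 1] g[of 2] g[of 3] \<open>u \<noteq> v\<close>
    by (cases s rule: node_cases; cases u rule: index_cases; cases v rule: index_cases; cases i rule: index_cases)
      (simp_all add: tail_def step_def)
  then show "g (tail s v) = g (head s u)"
    "g (head s i) \<in> {g (head s u), g (head s u) + 1}" "g (tail s i) \<in> {g (head s u), g (head s u) + 1}"
    by blast+
qed

text \<open>The disjuncts are shaped for \<open>linked_rep_step\<close>, which passes from a lattice
  point to the next one along a \<open>step\<close>.\<close>

lemma corner_adjacent:
  "tail s j = head s i \<or> tail s j = head s i + step (i + 1) \<or> head s i = tail s j + step i
    \<or> tail s j = head s i + step (i + 2)"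
  by (cases s rule: node_cases; cases i rule: index_cases; cases j rule: index_cases)
    (simp_all add: tail_def step_def index_mod_3)

lemma cell_adjacent_sym: "cell_adjacent w w' \<longleftrightarrow> cell_adjacent w' w"
  unfolding cell_adjacent_def by (metis add_diff_cancel_right' diff_add_cancel)

locale two_surfaces =
  fixes U W :: "cell set"
  assumes surface_U: "surface U" and surface_W: "surface W"
begin

text \<open>With this sign the gap is negative exactly over the cells of \<open>W - U\<close>, and
  its absolute value then counts those cells on the line.\<close>

definition gap :: "int \<times> int \<Rightarrow> int" where
  "gap P = height U P - height W P"

definition linked :: "cell \<Rightarrow> cell \<Rightarrow> bool" where
  "linked w w' \<longleftrightarrow> (w, w') \<in> {(w, w'). w \<in> W - U \<and> w' \<in> W - U \<and> cell_adjacent w w'}\<^sup>*"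

text \<open>Where the gap is negative, this is the lowest cell of \<open>W - U\<close> on the line
  \<open>P\<close>.\<close>

definition rep :: "int \<times> int \<Rightarrow> cell" where
  "rep P = cell_at P (height U P)"

abbreviation single :: "node \<Rightarrow> bool" where
  "single s \<equiv> dir U s \<noteq> dir W s"

abbreviation turn_U :: "node \<Rightarrow> node" where
  "turn_U s \<equiv> nb s (dir U s)"

abbreviation turn_W :: "node \<Rightarrow> node" where
  "turn_W s \<equiv> nb s (dir W s)"

text \<open>A path runs between two consecutive values of the gap; at a node with two different
  dimers this corner has the lower value (\<open>gap_corners\<close>).\<close>

definition low :: "node \<Rightarrow> int \<times> int" where
  "low s = head s (dir U s)"

text \<open>The shifts \<open>of_bool (i = 3)\<close> cancel. The gap changes only across edges that
  carry exactly one of the two dimers, so paths are its level curves.\<close>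

lemma gap_diff: "gap (head s i) - gap (tail s i) = of_bool (dir W s = i) - of_bool (dir U s = i)"
  using height_diff[OF surface_U, of s i] height_diff[OF surface_W, of s i]
  by (simp add: gap_def dir_iff[OF surface_U] dir_iff[OF surface_W])

lemma gap_corners:
  assumes "single s"
  shows "gap (tail s (dir U s)) = gap (low s) + 1" "gap (tail s (dir W s)) = gap (low s)"
    "gap (head s i) \<in> {gap (low s), gap (low s) + 1}" "gap (tail s i) \<in> {gap (low s), gap (low s) + 1}"
  unfolding low_def using corner_values[OF gap_diff[of s] assms] by auto

lemma linked_refl [simp]: "linked w w"
  by (simp add: linked_def)

lemma linked_trans: "linked w w' \<Longrightarrow> linked w' w'' \<Longrightarrow> linked w w''"
  unfolding linked_def by (rule rtrancl_trans)

lemma linked_sym: "linked w w' \<Longrightarrow> linked w' w"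
proof -
  have "sym {(w, w'). w \<in> W - U \<and> w' \<in> W - U \<and> cell_adjacent w w'}"
    by (auto simp: sym_def cell_adjacent_sym)
  then show "linked w w' \<Longrightarrow> linked w' w"
    unfolding linked_def by (meson sym_rtrancl symD)
qed

text \<open>Every cell between \<open>w\<close> and \<open>w'\<close> is outside \<open>U\<close>
  because it dominates \<open>w\<close>, and inside \<open>W\<close> because \<open>w'\<close>
  dominates it; so any monotone walk stays in \<open>W - U\<close>.\<close>

lemma linked_le:
  assumes "w \<in> W - U" "w' \<in> W - U" "\<And>j. w $ j \<le> w' $ j"
  shows "linked w w'"
  using assms
proof (induction "nat (\<Sum>j\<in>UNIV. w' $ j - w $ j)" arbitrary: w rule: less_induct)
  case less
  show ?case
  proof (cases "w = w'")
    case False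
    then obtain i where i: "w $ i < w' $ i"
      using less.prems(3) by (metis order_le_imp_less_or_eq vec_eq_iff)
    let ?v = "w + axis i 1"
    have le: "?v $ j \<le> w' $ j" "w $ j \<le> ?v $ j" for j
      using i less.prems(3)[of j] by (auto simp: axis_def)
    then have v: "?v \<in> W - U"
      using surface_down[OF surface_U, of ?v w] surface_down[OF surface_W, of w' ?v] less.prems(1,2) by blast
    have "(\<Sum>j\<in>UNIV. w' $ j - ?v $ j) < (\<Sum>j\<in>UNIV. w' $ j - w $ j)"
      by (rule sum_strict_mono_ex1) (auto simp: axis_def)
    moreover have "0 \<le> (\<Sum>j\<in>UNIV. w' $ j - ?v $ j)" using le(1) by (intro sum_nonneg) simp
    ultimately have "linked ?v w'" using less.hyps[of ?v] v less.prems(2) le(1) by simp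
    moreover have "linked w ?v"
      unfolding linked_def using v less.prems(1) by (intro r_into_rtrancl) (auto simp: cell_adjacent_def)
    ultimately show ?thesis using linked_trans by blast
  qed simp
qed

lemma between_iff: "w \<in> W - U \<longleftrightarrow> height U (line w) \<le> w $ 3 \<and> w $ 3 < height W (line w)"
  using in_surface_iff[OF surface_U, of w] in_surface_iff[OF surface_W, of w] by auto

lemma gap_neg_iff: "gap P < 0 \<longleftrightarrow> (\<exists>w \<in> W - U. line w = P)"
proof
  assume "gap P < 0"
  then have "cell_at P (height U P) \<in> W - U" unfolding between_iff by (simp add: gap_def)
  then show "\<exists>w \<in> W - U. line w = P" by (metis line_cell_at)
next
  assume "\<exists>w \<in> W - U. line w = P"
  then obtain w where "w \<in> W - U" "line w = P" by blast
  then show "gap P < 0" using between_iff[of w] by (simp add: gap_def)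
qed

lemma gap_pos_iff: "gap P > 0 \<longleftrightarrow> (\<exists>w \<in> U - W. line w = P)"
proof
  assume "gap P > 0"
  then have "cell_at P (height W P) \<in> U - W"
    by (simp add: gap_def cell_at_in_iff[OF surface_U] cell_at_in_iff[OF surface_W])
  then show "\<exists>w \<in> U - W. line w = P" by (metis line_cell_at)
next
  assume "\<exists>w \<in> U - W. line w = P"
  then show "gap P > 0"
    by (auto simp: gap_def in_surface_iff[OF surface_U] in_surface_iff[OF surface_W])
qed

lemma rep_between: "gap P < 0 \<Longrightarrow> rep P \<in> W - U"
  unfolding between_iff by (simp add: gap_def rep_def)

lemma linked_rep: "w \<in> W - U \<Longrightarrow> linked (rep (line w)) w"
proof -
  assume w: "w \<in> W - U"
  then have "rep (line w) \<in> W - U" using rep_between gap_neg_iff by blast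
  moreover have "rep (line w) $ j \<le> w $ j" for j
    using w cell_at_mono[of "height U (line w)" "w $ 3" "line w" j] unfolding between_iff by (simp add: rep_def)
  ultimately show ?thesis using w linked_le by blast
qed

text \<open>The height of \<open>U\<close> has only two possible values at the next point, and for
  both of them the two representatives are comparable, so that \<open>linked_le\<close>
  applies.\<close>

lemma linked_rep_step:
  assumes "gap P < 0" "gap (P + step i) < 0"
  shows "linked (rep P) (rep (P + step i))"
proof -
  have "height U (P + step i) = height U P - 1 + of_bool (i = 3) \<or> height U (P + step i) = height U P + of_bool (i = 3)"
    using height_step[OF surface_U, of P i] by auto
  then have "rep (P + step i) = cell_at P (height U P - 1) + axis i 1 \<or> rep (P + step i) = rep P + axis i 1"
    unfolding rep_def by (auto simp: cell_at_step)
  moreover have "(cell_at P (height U P - 1) + axis i 1) $ j \<le> rep P $ j" "rep P $ j \<le> (rep P + axis i 1) $ j" for j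
    by (cases j rule: index_cases; simp add: rep_def axis_def)+
  ultimately have "(\<forall>j. rep (P + step i) $ j \<le> rep P $ j) \<or> (\<forall>j. rep P $ j \<le> rep (P + step i) $ j)"
    by metis
  then show ?thesis using linked_le rep_between assms linked_sym by blast
qed

lemma linked_rep_corners:
  assumes "gap (head s i) < 0" "gap (tail s j) < 0"
  shows "linked (rep (head s i)) (rep (tail s j))"
  using corner_adjacent[of s j i] assms linked_rep_step linked_sym by (metis linked_refl)

section \<open>Invariants along a path\<close>

lemma turn_involutive [simp]: "turn_U (turn_U s) = s" "turn_W (turn_W s) = s"
  using dir_nb[OF surface_U, of s "dir U s"] dir_nb[OF surface_W, of s "dir W s"] by simp_all

lemma dir_turn [simp]: "dir U (turn_U s) = dir U s" "dir W (turn_W s) = dir W s"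
  using dir_nb[OF surface_U, of s "dir U s"] dir_nb[OF surface_W, of s "dir W s"] by simp_all

lemma single_turn:
  assumes "single s"
  shows "single (turn_U s)" "single (turn_W s)"
  using dir_nb[OF surface_W, of s "dir U s"] dir_nb[OF surface_U, of s "dir W s"] assms by auto

text \<open>What stays fixed along a path: the gap on its lower side and, where this is negative and
  \<open>rep\<close> lies in \<open>W - U\<close>, the component of \<open>W - U\<close> over that
  side.\<close>

definition same_level :: "node \<Rightarrow> node \<Rightarrow> bool" where
  "same_level s t \<longleftrightarrow> gap (low s) = gap (low t) \<and> (gap (low s) < 0 \<longrightarrow> linked (rep (low s)) (rep (low t)))"

lemma same_level_refl [simp]: "same_level s s"
  by (simp add: same_level_def)

lemma same_level_sym: "same_level s t \<Longrightarrow> same_level t s"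
  unfolding same_level_def using linked_sym by auto

lemma same_level_trans: "same_level s t \<Longrightarrow> same_level t r \<Longrightarrow> same_level s r"
  unfolding same_level_def using linked_trans by auto

text \<open>Turning along a \<open>U\<close>-dimer keeps \<open>low\<close>. Turning along a
  \<open>W\<close>-dimer may change it, but the tail of the crossed edge is a corner of both nodes
  and has the low gap at both.\<close>

lemma same_level_turn:
  assumes "single s"
  shows "same_level s (turn_U s)" "same_level s (turn_W s)"
proof -
  show "same_level s (turn_U s)" by (simp add: same_level_def low_def)
  let ?t = "turn_W s"
  have "gap (tail s (dir W s)) = gap (low s)" using gap_corners(2) assms by blast
  moreover have "gap (tail s (dir W s)) = gap (low ?t)"
    using gap_corners(2)[of ?t] single_turn(2)[OF assms] by simp
  moreover have "linked (rep (low s)) (rep (tail s (dir W s)))"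
    if "gap (low s) < 0" "gap (tail s (dir W s)) < 0"
    using that linked_rep_corners unfolding low_def by blast
  moreover have "linked (rep (low ?t)) (rep (tail s (dir W s)))"
    if "gap (low ?t) < 0" "gap (tail s (dir W s)) < 0"
    using that linked_rep_corners[of ?t "dir U ?t" "dir W s"] unfolding low_def by simp
  ultimately show "same_level s ?t"
    unfolding same_level_def using linked_trans linked_sym by metis
qed

lemma same_level_path:
  assumes "\<And>n::int. single (F n)" "\<And>n. F (n + 1) \<in> {turn_U (F n), turn_W (F n)}"
  shows "same_level (F 0) (F n)"
proof -
  have F: "same_level (F n) (F (n + 1))" for n
    using assms(2)[of n] same_level_turn[OF assms(1)[of n]] by auto
  show ?thesis
  proof (induction n rule: int_induct[of _ 0])
    case (step1 n)
    then show ?case using F[of n] same_level_trans by blast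
  next
    case (step2 n)
    have "same_level (F (n - 1)) (F n)" using F[of "n - 1"] by simp
    then show ?case using step2 same_level_trans same_level_sym by blast
  qed simp
qed

end

subsection \<open>Bi-infinite paths\<close>

lemma int_antidifference:
  fixes F :: "int \<Rightarrow> int"
  shows "\<exists>G. G 0 = 0 \<and> (\<forall>n. G (n + 1) - G n = F n)"
proof -
  define G where "G n = (if 0 \<le> n then sum F {0..<n} else - sum F {n..<0})" for n
  have "G (n + 1) - G n = F n" for n
  proof (cases "0 \<le> n")
    case True
    then have "{0..<n + 1} = insert n {0..<n}" by auto
    then show ?thesis using True by (simp add: G_def)
  next
    case False
    then have "{n..<0} = insert n {n + 1..<0}" by auto
    moreover have "sum F {0..<n + 1} = 0" "sum F {n + 1..<0} = 0" if "n = -1"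
      using that by simp_all
    ultimately show ?thesis using False by (cases "n = -1") (auto simp: G_def)
  qed
  then show ?thesis by (intro exI[of _ G]) (simp add: G_def)
qed

text \<open>A discrete Poincare lemma: \<open>nb\<close> makes \<open>c\<close> a function of
  directed lattice edges, and \<open>closed\<close> lets it vanish round every triangle.\<close>

lemma closed_form_exact:
  fixes c :: "node \<Rightarrow> 3 \<Rightarrow> int"
  assumes nb: "\<And>s i. c (nb s i) i = c s i" and closed: "\<And>s. c s 1 + c s 2 + c s 3 = 0"
  obtains g where "\<And>s i. g (head s i) - g (tail s i) = c s i"
proof -
  obtain X where X: "\<And>a. X (a + 1) - X a = c (False, a, 0) 1"
    using int_antidifference[of "\<lambda>a. c (False, a, 0) 1"] by blast
  have "\<forall>a. \<exists>Y. Y 0 = 0 \<and> (\<forall>b. Y (b + 1) - Y b = c (True, a, b) 2)"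
    by (intro allI int_antidifference)
  from choice[OF this] obtain Y where "\<forall>a. Y a 0 = 0 \<and> (\<forall>b. Y a (b + 1) - Y a b = c (True, a, b) 2)" ..
  then have Y0: "Y a 0 = 0" and Y: "Y a (b + 1) - Y a b = c (True, a, b) 2" for a b
    by blast+
  \<comment> \<open>Integrate along row 0, then along each column.\<close>
  define g where "g P = X (fst P) + Y (fst P) (snd P)" for P
  have y: "g (a, b + 1) - g (a, b) = c (True, a, b) 2" for a b
    using Y[of a b] by (simp add: g_def)
  \<comment> \<open>The two triangles of a unit square share its diagonal, whose value is
    eliminated; the form vanishes round the square.\<close>
  have rel: "c (False, a, b + 1) 1 = c (False, a, b) 1 + c (True, a + 1, b) 2 - c (True, a, b) 2" for a b
    using nb[of "(True, a, b)" 1] nb[of "(False, a, b)" 2] nb[of "(False, a, b)" 3]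
      closed[of "(False, a, b)"] closed[of "(True, a, b)"] by simp
  have x: "g (a + 1, b) - g (a, b) = c (False, a, b) 1" for a b
  proof (induction b rule: int_induct[of _ 0])
    case base
    then show ?case using X[of a] by (simp add: g_def Y0)
  next
    case (step1 b)
    then show ?case using rel[of a b] y[of a b] y[of "a + 1" b] by simp
  next
    case (step2 b)
    then show ?case using rel[of a "b - 1"] y[of a "b - 1"] y[of "a + 1" "b - 1"] by simp
  qed
  have up: "g (head s i) - g (tail s i) = c s i" if "\<not> fst s" for s i
  proof -
    obtain a b where s: "s = (False, a, b)" using \<open>\<not> fst s\<close> by (cases s rule: node_cases) auto
    have 1: "g (head s 1) - g (tail s 1) = c s 1"
      using x[of a b] by (simp add: s tail_def step_def)
    have 2: "g (head s 2) - g (tail s 2) = c s 2"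
      using y[of "a + 1" b] nb[of s 2] by (simp add: s tail_def step_def)
    show ?thesis
      using 1 2 closed[of s] sum_around_node[of g s] by (cases i rule: index_cases) (simp_all add: sum_3)
  qed
  have "g (head s i) - g (tail s i) = c s i" for s i
    using up[of s i] up[of "nb s i" i] nb[of s i] by (cases "fst s") auto
  then show thesis by (rule that)
qed

lemma finite_heads: "finite X \<Longrightarrow> finite {s. \<exists>i. head s i \<in> X}"
proof -
  assume X: "finite X"
  have "{s. \<exists>i. head s i \<in> X} \<subseteq> (\<Union>c\<in>UNIV. \<Union>i\<in>UNIV. node_at c i ` X)"
  proof
    fix s assume "s \<in> {s. \<exists>i. head s i \<in> X}"
    then obtain i where "head s i \<in> X" by blast
    then have "s \<in> node_at (fst s) i ` X"
      using node_at_head[of s i, symmetric] by (rule image_eqI[rotated])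
    then show "s \<in> (\<Union>c\<in>UNIV. \<Union>i\<in>UNIV. node_at c i ` X)" by blast
  qed
  moreover have "finite (\<Union>c\<in>UNIV. \<Union>i\<in>UNIV. node_at c i ` X)"
    using X by (intro finite_UN_I finite_imageI) auto
  ultimately show ?thesis by (rule finite_subset)
qed

lemma finite_tails: "finite X \<Longrightarrow> finite {s. \<exists>i. tail s i \<in> X}"
proof -
  assume "finite X"
  then have "finite {s. \<exists>i. head s i \<in> (\<Union>i\<in>UNIV. (\<lambda>P. P + step i) ` X)}"
    by (intro finite_heads finite_UN_I finite_imageI) auto
  moreover have "{s. \<exists>i. tail s i \<in> X} \<subseteq> {s. \<exists>i. head s i \<in> (\<Union>i\<in>UNIV. (\<lambda>P. P + step i) ` X)}"
    unfolding head_eq by blast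
  ultimately show ?thesis by (rule finite_subset[rotated])
qed

section \<open>Bi-infinite paths as orbits of two matchings\<close>

context two_surfaces begin

lemma bi_infinite_path_nodes:
  assumes D: "\<And>e. D e > 0 \<longleftrightarrow> e \<in> dimers U \<or> e \<in> dimers W" and f: "bi_infinite_path D f"
  obtains F where "\<And>n. f n = tri (F n)" "inj F" "\<And>n. F (n + 1) \<in> {turn_U (F n), turn_W (F n)}"
    "\<And>n. single (F n)"
proof -
  have D': "D e > 0 \<longleftrightarrow> (\<exists>s. e = {tri s, tri (turn_U s)} \<or> e = {tri s, tri (turn_W s)})" for e
    unfolding D dimers_eq[OF surface_U] dimers_eq[OF surface_W] by blast
  have edges: "{e. D e > 0 \<and> e \<inter> range f \<noteq> {}} = range (\<lambda>n. {f n, f (n + 1)})" and "inj f"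
    using f unfolding bi_infinite_path_def by auto
  have D_step: "D {f n, f (n + 1)} > 0" for n using edges by blast
  have "\<exists>s. f n = tri s" for n
    using D_step[of n] unfolding D' doubleton_eq_iff by blast
  then obtain F where F: "\<And>n. f n = tri (F n)" by metis
  have "inj F" using \<open>inj f\<close> unfolding inj_def F by auto
  have pair: "{tri s, tri t} = {tri s', tri t'} \<longleftrightarrow> s = s' \<and> t = t' \<or> s = t' \<and> t = s'" for s t s' t'
    by (metis doubleton_eq_iff tri_inj)
  have next_node: "F (n + 1) = turn_U (F n) \<or> F (n + 1) = turn_W (F n)" for n
    using D_step[of n] unfolding D' F pair by (metis turn_involutive)
  \<comment> \<open>At a doubled edge the predecessor and the successor on the path would be the
    same node, against injectivity.\<close>
  have "single (F n)" for n
  proof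
    assume same: "dir U (F n) = dir W (F n)"
    have 1: "F (n + 1) = turn_U (F n)" using next_node[of n] same by auto
    have "F n = turn_U (F (n - 1)) \<or> F n = turn_W (F (n - 1))" using next_node[of "n - 1"] by simp
    then have "F (n - 1) = turn_U (F n)" using turn_involutive same by metis
    with 1 have "F (n + 1) = F (n - 1)" by simp
    then show False using \<open>inj F\<close> by (simp add: inj_eq)
  qed
  with F \<open>inj F\<close> next_node show thesis by (intro that[of F]) auto
qed

text \<open>This walks through the component of \<open>s\<close>. Each turn is its own inverse, so
  the orbit continues to negative indices with the two turns exchanged.\<close>

lemma alternating_orbit:
  obtains F where "F (0::int) = s" "\<And>n. F (n + 1) = (if even n then turn_U (F n) else turn_W (F n))"
proof -
  define r where "r = rec_nat s (\<lambda>k x. if even k then turn_U x else turn_W x)"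
  define l where "l = rec_nat s (\<lambda>k x. if even k then turn_W x else turn_U x)"
  have r: "r 0 = s" "r (Suc k) = (if even k then turn_U (r k) else turn_W (r k))" for k
    by (simp_all add: r_def)
  have l: "l 0 = s" "l (Suc k) = (if even k then turn_W (l k) else turn_U (l k))" for k
    by (simp_all add: l_def)
  define F where "F n = (if 0 \<le> n then r (nat n) else l (nat (- n)))" for n :: int
  have "F (n + 1) = (if even n then turn_U (F n) else turn_W (F n))" for n
  proof (cases "0 \<le> n")
    case True
    then have "nat (n + 1) = Suc (nat n)" "even (nat n) = even n" by (simp_all add: even_nat_iff nat_add_distrib)
    then show ?thesis using True r(2)[of "nat n"] by (simp add: F_def)
  next
    case False
    define k where "k = nat (- n - 1)"
    have k: "n = - int k - 1" using False by (simp add: k_def)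
    have "F (n + 1) = l k" using r(1) l(1) by (cases "k = 0") (simp_all add: F_def k)
    moreover have "F n = l (Suc k)" by (simp add: F_def k nat_add_distrib)
    ultimately show ?thesis using l(2)[of k] by (simp add: k)
  qed
  moreover have "F 0 = s" by (simp add: F_def r)
  ultimately show thesis by (rule that[rotated])
qed

text \<open>A repeated node makes the orbit periodic and hence its range finite.\<close>

lemma alternating_orbit_inj:
  fixes F :: "int \<Rightarrow> node"
  assumes F: "\<And>n. F (n + 1) = (if even n then turn_U (F n) else turn_W (F n))" and "infinite (range F)"
  shows "inj F"
proof (rule ccontr)
  assume "\<not> inj F"
  then obtain n m where nm: "F n = F m" "n < m" unfolding inj_def by (metis linorder_neqE)
  \<comment> \<open>Each turn changes the orientation of the triangle, so equal nodes have indices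
    of equal parity and are followed by the same turns.\<close>
  have color: "fst (F k) = (fst (F 0) = even k)" for k
  proof (induction k rule: int_induct[of _ 0])
    case (step1 k)
    then show ?case using F[of k] by auto
  next
    case (step2 k)
    then show ?case using F[of "k - 1"] by (cases "even k") auto
  qed simp
  have parity: "even n = even m" using color[of n] color[of m] nm(1) by auto
  have shift: "F (n + k) = F (m + k)" for k
  proof (induction k rule: int_induct[of _ 0])
    case base
    then show ?case using nm by simp
  next
    case (step1 k)
    then show ?case using F[of "n + k"] F[of "m + k"] parity by (simp add: add.assoc)
  next
    case (step2 k)
    have inj: "turn_U x = turn_U y \<longleftrightarrow> x = y" "turn_W x = turn_W y \<longleftrightarrow> x = y" for x y
      by (metis turn_involutive)+
    show ?case using F[of "n + (k - 1)"] F[of "m + (k - 1)"] parity step2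
      by (cases "even (n + k - 1)") (simp_all add: inj algebra_simps)
  qed
  define p where "p = m - n"
  have "p > 0" using nm by (simp add: p_def)
  have period: "F (x + p) = F x" for x using shift[of "x - n"] by (simp add: p_def algebra_simps)
  have "F (x + k * p) = F x" for x k
  proof (induction k rule: int_induct[of _ 0])
    case (step1 k)
    then show ?case using period[of "x + k * p"] by (simp add: algebra_simps)
  next
    case (step2 k)
    then show ?case using period[of "x + (k - 1) * p"] by (simp add: algebra_simps)
  qed simp
  then have "F x = F (x mod p)" for x
    using mod_div_mult_eq[of x p] by metis
  moreover have "x mod p \<in> {0..<p}" for x using \<open>p > 0\<close> by simp
  ultimately have "range F \<subseteq> F ` {0..<p}" by blast
  then show False using assms(2) finite_subset by blast
qed

text \<open>A node meets only its \<open>U\<close>-dimer and its \<open>W\<close>-dimer; the orbit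
  enters by one and leaves by the other, so no further edge meets the range.\<close>

lemma bi_infinite_pathI:
  assumes D: "\<And>e. D e > 0 \<longleftrightarrow> e \<in> dimers U \<or> e \<in> dimers W" and "inj F"
    and F: "\<And>n::int. F (n + 1) = (if even n then turn_U (F n) else turn_W (F n))"
  shows "bi_infinite_path D (\<lambda>n. tri (F n))"
proof -
  have D': "D e > 0 \<longleftrightarrow> (\<exists>s. e = {tri s, tri (turn_U s)} \<or> e = {tri s, tri (turn_W s)})" for e
    unfolding D dimers_eq[OF surface_U] dimers_eq[OF surface_W] by blast
  have prev: "F (n - 1) = (if even n then turn_W (F n) else turn_U (F n))" for n
    using F[of "n - 1"] by auto
  have "{e. D e > 0 \<and> e \<inter> range (\<lambda>n. tri (F n)) \<noteq> {}} = range (\<lambda>n. {tri (F n), tri (F (n + 1))})"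
  proof (intro equalityI subsetI)
    fix e assume "e \<in> {e. D e > 0 \<and> e \<inter> range (\<lambda>n. tri (F n)) \<noteq> {}}"
    then obtain n where "D e > 0" "tri (F n) \<in> e" by blast
    then obtain s t where st: "e = {tri s, tri t}" "t = turn_U s \<or> t = turn_W s"
      unfolding D' by blast
    have "F n = s \<or> F n = t" using \<open>tri (F n) \<in> e\<close> unfolding st(1) insert_iff tri_inj by blast
    then have "\<exists>r. e = {tri (F n), tri r} \<and> (r = turn_U (F n) \<or> r = turn_W (F n))"
    proof
      assume "F n = s" then show ?thesis using st by blast
    next
      assume t: "F n = t"
      have "s = turn_U t \<or> s = turn_W t" using st(2) by auto
      moreover have "e = {tri (F n), tri s}" unfolding st(1) t by (rule insert_commute)
      ultimately show ?thesis unfolding t by blast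
    qed
    then obtain r where r: "e = {tri (F n), tri r}" "r = turn_U (F n) \<or> r = turn_W (F n)" by blast
    then have "r = F (n + 1) \<or> r = F (n - 1)"
      using F[of n] prev[of n] by (cases "even n") auto
    then have "e = {tri (F n), tri (F (n + 1))} \<or> e = {tri (F n), tri (F (n - 1))}"
      using r(1) by blast
    then have "e = {tri (F n), tri (F (n + 1))} \<or> e = {tri (F (n - 1)), tri (F (n - 1 + 1))}"
      by (simp add: insert_commute)
    then show "e \<in> range (\<lambda>n. {tri (F n), tri (F (n + 1))})" by blast
  next
    fix e assume "e \<in> range (\<lambda>n. {tri (F n), tri (F (n + 1))})"
    then obtain n where n: "e = {tri (F n), tri (F (n + 1))}" by blast
    have "F (n + 1) = turn_U (F n) \<or> F (n + 1) = turn_W (F n)" using F[of n] by auto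
    then have "e = {tri (F n), tri (turn_U (F n))} \<or> e = {tri (F n), tri (turn_W (F n))}" using n by auto
    then have "D e > 0" unfolding D' by (rule exI)
    moreover have "tri (F n) \<in> e \<inter> range (\<lambda>n. tri (F n))" unfolding n by blast
    ultimately show "e \<in> {e. D e > 0 \<and> e \<inter> range (\<lambda>n. tri (F n)) \<noteq> {}}" by blast
  qed
  moreover have "inj (\<lambda>n. tri (F n))" using \<open>inj F\<close> unfolding inj_def tri_inj .
  ultimately show ?thesis unfolding bi_infinite_path_def by blast
qed

end

subsection \<open>The surfaces of an AB configuration\<close>

lemma young_diagram_nonneg: "(u, v) \<in> young_diagram la \<Longrightarrow> 0 \<le> u \<and> 0 \<le> v"
  by (simp add: young_diagram_def)

lemma young_diagram_down:
  assumes "is_partition la" "(u, v) \<in> young_diagram la" "0 \<le> u'" "u' \<le> u" "0 \<le> v'" "v' \<le> v"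
  shows "(u', v') \<in> young_diagram la"
proof -
  have "la ! nat v \<le> la ! nat v'"
  proof (cases "v' < v")
    case True
    then have "nat v' < nat v" using assms(5) by simp
    then show ?thesis using assms unfolding is_partition_def young_diagram_def
      by (auto intro: sorted_wrt_nth_less[of "(\<ge>)"])
  next
    case False
    then have "nat v' = nat v" using assms(6) by simp
    then show ?thesis by simp
  qed
  then show ?thesis using assms by (auto simp: young_diagram_def)
qed

lemma young_diagram_bound:
  assumes "(u, v) \<in> young_diagram la"
  shows "u < int (length la + sum_list la)" "v < int (length la + sum_list la)"
proof -
  have v: "0 \<le> v" "v < int (length la)" "u < int (la ! nat v)" using assms by (auto simp: young_diagram_def)
  then have "la ! nat v \<in> set la" by (intro nth_mem) linarith
  then have "la ! nat v \<le> sum_list la" by (rule member_le_sum_list) simp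
  then show "u < int (length la + sum_list la)" "v < int (length la + sum_list la)" using v by linarith+
qed

lemma index_add [simp]: "i + 1 + 1 = i + (2::3)" "i + 1 + 2 = i" "i + 2 + 1 = i" "i + 2 + 2 = i + (1::3)"
  by (simp_all add: add.assoc index_mod_3)

lemma index_add_distinct [simp]: "i \<noteq> i + (1::3)" "i \<noteq> i + (2::3)" "i + 1 \<noteq> i + (2::3)"
   "i + (1::3) \<noteq> i" "i + (2::3) \<noteq> i" "i + 2 \<noteq> i + (1::3)"
  by simp_all

lemma index_eq_cases: "j = i \<or> j = i + 1 \<or> j = i + (2::3)"
  by (cases i rule: index_cases; cases j rule: index_cases) (simp_all add: index_mod_3)

lemma all_index_from: "(\<forall>j. P j) \<longleftrightarrow> P i \<and> P (i + 1) \<and> P (i + (2::3))"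
  by (metis index_eq_cases)

lemma down_closed_steps:
  assumes "\<And>w i. w \<in> U \<Longrightarrow> w - axis i 1 \<in> U"
  shows "down_closed U"
proof -
  have "w' \<in> U" if "w \<in> U" "\<forall>j. w' $ j \<le> w $ j" for w w'
    using that
  proof (induction "nat (\<Sum>j\<in>UNIV. w $ j - w' $ j)" arbitrary: w rule: less_induct)
    case less
    show ?case
    proof (cases "w = w'")
      case False
      then obtain i where i: "w' $ i < w $ i"
        using less.prems(2) by (metis order_le_imp_less_or_eq vec_eq_iff)
      let ?v = "w - axis i 1"
      have le: "w' $ j \<le> ?v $ j" for j
        using i less.prems(2)[THEN spec, of j] by (auto simp: axis_def)
      have "(\<Sum>j\<in>UNIV. ?v $ j - w' $ j) < (\<Sum>j\<in>UNIV. w $ j - w' $ j)"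
        by (rule sum_strict_mono_ex1) (auto simp: axis_def)
      moreover have "0 \<le> (\<Sum>j\<in>UNIV. ?v $ j - w' $ j)" using le by (intro sum_nonneg) simp
      ultimately show ?thesis using less.hyps[of ?v] assms[OF less.prems(1)] le by simp
    qed (use less.prems in simp)
  qed
  then show ?thesis unfolding down_closed_def by blast
qed

section \<open>Cylinders and regions by coordinates\<close>

lemma octant_iff: "w \<in> octant \<longleftrightarrow> (\<forall>j. 0 \<le> w $ j)"
  by (simp add: octant_def)

lemma cyl_iff: "w \<in> cyl \<mu> i \<longleftrightarrow> (w $ (i + 1), w $ (i + 2)) \<in> young_diagram (\<mu> i)"
  by (simp add: cyl_def)

lemma cyl_nonneg: "w \<in> cyl \<mu> i \<Longrightarrow> j \<noteq> i \<Longrightarrow> 0 \<le> w $ j"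
  using young_diagram_nonneg[of "w $ (i + 1)" "w $ (i + 2)" "\<mu> i"] index_eq_cases[of j i] by (auto simp: cyl_iff)

lemma cyl_minus_iff: "w \<in> cyl_minus \<mu> i \<longleftrightarrow> w \<in> cyl \<mu> i \<and> w $ i < 0"
  unfolding cyl_minus_def octant_iff using cyl_nonneg[of w \<mu> i] by (metis Diff_iff not_le octant_iff)

lemma I_minus_iff: "w \<in> I_minus \<mu> \<longleftrightarrow> (\<exists>i. w \<in> cyl \<mu> i \<and> w $ i < 0)"
  by (simp add: I_minus_def cyl_minus_iff)

lemma III_iff: "w \<in> III \<mu> \<longleftrightarrow> (\<forall>i. w \<in> cyl \<mu> i)"
  by (simp add: III_def)

lemma II_bar_iff: "w \<in> II_bar \<mu> i \<longleftrightarrow> w \<in> cyl \<mu> (i + 1) \<and> w \<in> cyl \<mu> (i + 2) \<and> w \<notin> cyl \<mu> i"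
  by (auto simp: II_bar_def)

lemma II_iff: "w \<in> II \<mu> \<longleftrightarrow> (\<exists>i. w \<in> II_bar \<mu> i)"
  by (simp add: II_def)

lemma II_III_iff: "w \<in> II \<mu> \<union> III \<mu> \<longleftrightarrow> (\<exists>i. w \<in> cyl \<mu> (i + 1) \<and> w \<in> cyl \<mu> (i + 2))"
  unfolding Un_iff II_iff II_bar_iff III_iff using all_index_from[of "\<lambda>j. w \<in> cyl \<mu> j"] by blast

text \<open>Cylinder \<open>i\<close> leaves only coordinate \<open>i\<close> free to be negative,
  and two different cylinders leave none.\<close>

lemma two_cyl_octant:
  assumes "w \<in> cyl \<mu> i" "w \<in> cyl \<mu> j" "i \<noteq> j"
  shows "w \<in> octant"
  unfolding octant_iff using assms cyl_nonneg by metis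

lemma II_III_octant: "w \<in> II \<mu> \<union> III \<mu> \<Longrightarrow> w \<in> octant"
  unfolding II_III_iff using two_cyl_octant by (metis index_add_distinct(3))

locale AB_pair =
  fixes \<mu> :: "3 \<Rightarrow> nat list" and A B :: "cell set"
  assumes partition: "\<And>i. is_partition (\<mu> i)" and AB: "AB_configuration \<mu> A B"
begin

lemma cyl_down:
  assumes "w \<in> cyl \<mu> l" "i = l \<or> 0 < w $ i"
  shows "w - axis i 1 \<in> cyl \<mu> l"
proof (cases "i = l")
  case True
  then show ?thesis using assms(1) by (simp add: cyl_iff axis_def)
next
  case False
  then have "0 < w $ i" using assms(2) by simp
  then have "0 \<le> (w - axis i 1) $ j" if "j \<noteq> l" for j
    using cyl_nonneg[OF assms(1) that] by (auto simp: axis_def)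
  then show ?thesis
    using assms(1) partition[of l] unfolding cyl_iff
    by (elim young_diagram_down[rotated]) (auto simp: axis_def)
qed

text \<open>A crude bound common to all three cylinders: a cell with a coordinate of at least this
  size can lie only in the cylinder along that coordinate (\<open>cyl_bound\<close>).\<close>

definition size_bound :: int where
  "size_bound = (\<Sum>i\<in>UNIV. int (length (\<mu> i) + sum_list (\<mu> i)))"

lemma cyl_bound:
  assumes "w \<in> cyl \<mu> i" "j \<noteq> i"
  shows "w $ j < size_bound"
proof -
  have "int (length (\<mu> i) + sum_list (\<mu> i)) \<le> size_bound"
    unfolding size_bound_def by (rule member_le_sum) auto
  moreover have "w $ j < int (length (\<mu> i) + sum_list (\<mu> i))"
    using young_diagram_bound assms index_eq_cases[of j i] by (auto simp: cyl_iff)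
  ultimately show ?thesis by linarith
qed

text \<open>Two different cylinders together bound all three coordinates.\<close>

lemma finite_II_III: "finite (II \<mu> \<union> III \<mu>)"
proof -
  let ?I = "{0..<size_bound}"
  have "II \<mu> \<union> III \<mu> \<subseteq> (\<lambda>(x, y, z). vector [x, y, z]) ` (?I \<times> ?I \<times> ?I)"
  proof
    fix w assume w: "w \<in> II \<mu> \<union> III \<mu>"
    then obtain i where i: "w \<in> cyl \<mu> (i + 1)" "w \<in> cyl \<mu> (i + 2)" unfolding II_III_iff by blast
    then have "w $ j \<in> ?I" for j
      using II_III_octant[OF w] cyl_bound[OF i(1), of j] cyl_bound[OF i(2), of j]
      by (cases "j = i + 1") (auto simp: octant_iff)
    moreover have "w = (\<lambda>(x, y, z). vector [x, y, z]) (w $ 1, w $ 2, w $ 3)" by (simp add: vector_3_eta)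
    ultimately show "w \<in> (\<lambda>(x, y, z). vector [x, y, z]) ` (?I \<times> ?I \<times> ?I)"
      by (metis (no_types, lifting) SigmaI image_eqI)
  qed
  then show ?thesis by (rule finite_subset) simp
qed

lemma closed_A: "w \<in> I_minus \<mu> \<union> III \<mu> \<Longrightarrow> w - axis i 1 \<in> A \<Longrightarrow> w \<in> A"
  and closed_B: "w \<in> II \<mu> \<union> III \<mu> \<Longrightarrow> w - axis i 1 \<in> B \<Longrightarrow> w \<in> B"
  and finite_A: "finite A"
  using AB unfolding AB_configuration_def closed_in_def by blast+

text \<open>A step down from a cell outside \<open>A\<close> cannot enter \<open>A\<close>, which is
  closed upwards in its region. If the step leaves the region, it produces a second negative
  coordinate.\<close>

lemma down_closed_U_A: "down_closed (U_A \<mu> A)"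
proof (rule down_closed_steps)
  fix w i assume "w \<in> U_A \<mu> A"
  then consider j k where "j \<noteq> k" "w $ j < 0" "w $ k < 0" | "w \<in> I_minus \<mu> \<union> III \<mu>" "w \<notin> A"
    unfolding U_A_def by blast
  then show "w - axis i 1 \<in> U_A \<mu> A"
  proof cases
    case 1
    then have "(w - axis i 1) $ j < 0" "(w - axis i 1) $ k < 0" by (auto simp: axis_def)
    then show ?thesis using 1(1) unfolding U_A_def by blast
  next
    case 2
    have "w - axis i 1 \<notin> A" using closed_A 2 by blast
    moreover have "w - axis i 1 \<in> I_minus \<mu> \<union> III \<mu> \<or> (\<exists>j k. j \<noteq> k \<and> (w - axis i 1) $ j < 0 \<and> (w - axis i 1) $ k < 0)"
    proof (cases "w \<in> III \<mu>")
      case True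
      show ?thesis
      proof (cases "0 < w $ i")
        case True
        then show ?thesis using \<open>w \<in> III \<mu>\<close> cyl_down by (auto simp: III_iff)
      next
        case False
        have "w - axis i 1 \<in> cyl \<mu> i" using True cyl_down by (auto simp: III_iff)
        moreover have "(w - axis i 1) $ i < 0" using False by (simp add: axis_def)
        ultimately show ?thesis by (auto simp: I_minus_iff)
      qed
    next
      case False
      then obtain l where l: "w \<in> cyl \<mu> l" "w $ l < 0" using 2 by (auto simp: I_minus_iff)
      then have "(w - axis i 1) $ l < 0" by (auto simp: axis_def)
      show ?thesis
      proof (cases "i = l \<or> 0 < w $ i")
        case True
        then show ?thesis using cyl_down[OF l(1)] \<open>(w - axis i 1) $ l < 0\<close> by (auto simp: I_minus_iff)
      next
        case False
        then have "(w - axis i 1) $ i < 0" by (simp add: axis_def)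
        then show ?thesis using False \<open>(w - axis i 1) $ l < 0\<close> by blast
      qed
    qed
    ultimately show ?thesis unfolding U_A_def by blast
  qed
qed

lemma down_closed_U_B: "down_closed (U_B \<mu> B)"
proof (rule down_closed_steps)
  fix w i assume w: "w \<in> U_B \<mu> B"
  show "w - axis i 1 \<in> U_B \<mu> B"
  proof (cases "w - axis i 1 \<in> octant")
    case True
    have w_oct: "w \<in> octant"
      unfolding octant_iff
    proof
      fix j
      have "0 \<le> (w - axis i 1) $ j" using True unfolding octant_iff by blast
      then show "0 \<le> w $ j" by (auto simp: axis_def split: if_splits)
    qed
    have "0 \<le> (w - axis i 1) $ i" using True unfolding octant_iff by blast
    then have "0 < w $ i" by (simp add: axis_def)
    moreover have "w \<in> II \<mu> \<union> III \<mu>" "w \<notin> B" using w w_oct unfolding U_B_def by auto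
    ultimately have "w - axis i 1 \<in> II \<mu> \<union> III \<mu>" "w - axis i 1 \<notin> B"
      using cyl_down closed_B unfolding II_III_iff by blast+
    then show ?thesis unfolding U_B_def by blast
  qed (simp add: U_B_def)
qed

lemma far_cell: "size_bound \<le> t - \<bar>fst P\<bar> - \<bar>snd P\<bar> \<Longrightarrow> size_bound \<le> cell_at P t $ j"
  by (cases j rule: index_cases) auto

lemma size_bound_nonneg: "0 \<le> size_bound"
  unfolding size_bound_def by (intro sum_nonneg) simp

lemma surface_U_A: "surface (U_A \<mu> A)"
  unfolding surface_def
proof (intro conjI allI down_closed_U_A)
  fix P :: "int \<times> int"
  have "cell_at P (- \<bar>fst P\<bar> - 1) $ 1 < 0" "cell_at P (- \<bar>fst P\<bar> - 1) $ 3 < 0" by auto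
  then have "cell_at P (- \<bar>fst P\<bar> - 1) \<in> U_A \<mu> A" unfolding U_A_def using index_distinct(3) by blast
  then show "\<exists>t. cell_at P t \<in> U_A \<mu> A" ..
  \<comment> \<open>Beyond \<open>size_bound\<close> in every coordinate, hence in no
    cylinder.\<close>
  let ?w = "cell_at P (size_bound + \<bar>fst P\<bar> + \<bar>snd P\<bar>)"
  have far: "size_bound \<le> ?w $ j" for j by (rule far_cell) simp
  then have "?w \<notin> cyl \<mu> i" for i using cyl_bound[of ?w i "i + 1"] by (metis index_add_distinct(4) not_le)
  moreover have "\<not> ?w $ j < 0" for j using far[of j] size_bound_nonneg by linarith
  ultimately have "?w \<notin> U_A \<mu> A" unfolding U_A_def I_minus_iff Un_iff III_iff mem_Collect_eq Diff_iff by blast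
  then show "\<exists>t. cell_at P t \<notin> U_A \<mu> A" ..
qed

lemma surface_U_B: "surface (U_B \<mu> B)"
  unfolding surface_def
proof (intro conjI allI down_closed_U_B)
  fix P :: "int \<times> int"
  have "cell_at P (- 1) $ 3 < 0" by simp
  then have "cell_at P (- 1) \<in> U_B \<mu> B"
    unfolding U_B_def Un_iff Compl_iff octant_iff by (meson not_le)
  then show "\<exists>t. cell_at P t \<in> U_B \<mu> B" ..
  let ?w = "cell_at P (size_bound + \<bar>fst P\<bar> + \<bar>snd P\<bar>)"
  have far: "size_bound \<le> ?w $ j" for j by (rule far_cell) simp
  then have "?w \<notin> cyl \<mu> i" for i using cyl_bound[of ?w i "i + 1"] by (metis index_add_distinct(4) not_le)
  moreover have "?w \<in> octant" unfolding octant_iff using far size_bound_nonneg by (meson order_trans)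
  ultimately have "?w \<notin> U_B \<mu> B" unfolding U_B_def Un_iff Diff_iff Compl_iff using II_III_iff[of ?w \<mu>] by blast
  then show "\<exists>t. cell_at P t \<notin> U_B \<mu> B" ..
qed

end

sublocale AB_pair \<subseteq> two_surfaces "U_A \<mu> A" "U_B \<mu> B"
  by unfold_locales (rule surface_U_A surface_U_B)+

subsection \<open>Labels and outer regions\<close>

context AB_pair begin

text \<open>The regions N_i of the opening comment, whose V is \<open>between\<close>.\<close>

definition outer :: "3 \<Rightarrow> cell set" where
  "outer i = {w. w $ i < 0 \<and> (\<forall>j. j \<noteq> i \<longrightarrow> 0 \<le> w $ j) \<and> w \<notin> cyl \<mu> i}"

definition between :: "cell set" where
  "between = U_B \<mu> B - U_A \<mu> A"

text \<open>The set whose components decide whether the configuration is labelled. It lies in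
  \<open>between\<close> except for the cells of III in \<open>B - A\<close>, where the surfaces
  cross the other way (\<open>inner_cases\<close>).\<close>

definition inner :: "cell set" where
  "inner = (I_minus \<mu> \<inter> A) \<union> (II \<mu> - B) \<union> (III \<mu> \<inter> ((A - B) \<union> (B - A)))"

definition kind :: "3 \<Rightarrow> cell set" where
  "kind i = cyl_minus \<mu> i \<union> II_bar \<mu> i"

lemma not_in_U_A:
  assumes "w \<in> A \<or> w \<notin> I_minus \<mu> \<union> III \<mu>" "\<And>j. j \<noteq> i \<Longrightarrow> 0 \<le> w $ j"
  shows "w \<notin> U_A \<mu> A"
proof -
  have "\<not> (\<exists>j k. j \<noteq> k \<and> w $ j < 0 \<and> w $ k < 0)" using assms(2) by (metis not_le)
  then show ?thesis using assms(1) unfolding U_A_def by blast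
qed

lemma not_octant: "w $ i < 0 \<Longrightarrow> w \<notin> octant"
  unfolding octant_iff by (metis not_le)

lemma III_octant: "w \<in> III \<mu> \<Longrightarrow> w \<in> octant"
  and II_octant: "w \<in> II \<mu> \<Longrightarrow> w \<in> octant"
  using II_III_octant by blast+

lemma octant_not_I_minus: "w \<in> octant \<Longrightarrow> w \<notin> I_minus \<mu>"
  unfolding I_minus_iff using not_octant by blast

lemma II_not_III: "w \<in> II \<mu> \<Longrightarrow> w \<notin> III \<mu>"
  unfolding II_iff II_bar_iff III_iff by blast

lemma outer_between: "outer i \<subseteq> between"
proof
  fix w assume w: "w \<in> outer i"
  then have "w \<notin> octant" using not_octant unfolding outer_def by blast
  moreover have "w \<notin> I_minus \<mu>"
  proof
    assume "w \<in> I_minus \<mu>"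
    then obtain l where l: "w \<in> cyl \<mu> l" "w $ l < 0" unfolding I_minus_iff by blast
    then have "l = i" using w unfolding outer_def by (metis (mono_tags, lifting) mem_Collect_eq not_le)
    then show False using w l(1) by (simp add: outer_def)
  qed
  moreover have "w \<notin> III \<mu>" using \<open>w \<notin> octant\<close> III_octant by blast
  ultimately have "w \<notin> U_A \<mu> A" using w by (intro not_in_U_A[of w i]) (auto simp: outer_def)
  then show "w \<in> between" using \<open>w \<notin> octant\<close> unfolding between_def U_B_def by blast
qed

lemma between_cases:
  assumes "w \<in> between"
  shows "(\<exists>i. w \<in> outer i) \<or> w \<in> inner"
proof (cases "w \<in> octant")
  case True
  then have "w \<in> II \<mu> \<union> III \<mu>" "w \<notin> B" using assms unfolding between_def U_B_def by auto
  moreover have "w \<in> III \<mu> \<Longrightarrow> w \<in> A" using assms unfolding between_def U_A_def by blast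
  ultimately show ?thesis unfolding inner_def by blast
next
  case False
  then obtain i where i: "w $ i < 0" unfolding octant_iff by (metis not_le)
  have "0 \<le> w $ j" if "j \<noteq> i" for j
    using assms i that unfolding between_def U_A_def by (metis (mono_tags, lifting) DiffD2 UnI1 mem_Collect_eq not_le)
  then have "w \<in> outer i \<or> w \<in> I_minus \<mu>" using i unfolding outer_def I_minus_iff by blast
  moreover have "w \<in> I_minus \<mu> \<Longrightarrow> w \<in> A" using assms unfolding between_def U_A_def by blast
  ultimately show ?thesis unfolding inner_def by blast
qed

lemma inner_cases:
  assumes "w \<in> inner"
  shows "w \<in> between \<or> w \<in> U_A \<mu> A - U_B \<mu> B \<and> w \<in> III \<mu>"
proof -
  have oct: "w \<notin> U_A \<mu> A" if "w \<in> octant" "w \<in> A \<or> w \<notin> III \<mu>"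
    using that octant_not_I_minus[OF that(1)] by (intro not_in_U_A[of w 1]) (auto simp: octant_iff)
  consider "w \<in> I_minus \<mu>" "w \<in> A" | "w \<in> II \<mu>" "w \<notin> B" | "w \<in> III \<mu>" "w \<in> A" "w \<notin> B"
    | "w \<in> III \<mu>" "w \<in> B" "w \<notin> A"
    using assms unfolding inner_def by blast
  then show ?thesis
  proof cases
    case 1
    then obtain l where l: "w \<in> cyl \<mu> l" "w $ l < 0" unfolding I_minus_iff by blast
    then have "w \<notin> U_A \<mu> A" using 1(2) cyl_nonneg by (intro not_in_U_A[of w l]) auto
    then show ?thesis using not_octant[OF l(2)] unfolding between_def U_B_def by blast
  next
    case 2
    then show ?thesis using oct[OF II_octant] II_not_III unfolding between_def U_B_def by blast
  next
    case 3
    then show ?thesis using oct[OF III_octant] unfolding between_def U_B_def by blast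
  next
    case 4
    then show ?thesis using III_octant unfolding U_A_def U_B_def by blast
  qed
qed

lemma outer_not_inner: "w \<in> outer i \<Longrightarrow> w \<notin> inner"
proof
  assume w: "w \<in> outer i" "w \<in> inner"
  then have "w \<notin> octant" using not_octant unfolding outer_def by blast
  then have "w \<notin> II \<mu>" "w \<notin> III \<mu>" using II_octant III_octant by blast+
  then have "w \<in> I_minus \<mu>" using w(2) unfolding inner_def by blast
  then obtain l where l: "w \<in> cyl \<mu> l" "w $ l < 0" unfolding I_minus_iff by blast
  then have "l = i" using w(1) unfolding outer_def by (metis (mono_tags, lifting) mem_Collect_eq not_le)
  then show False using w(1) l by (simp add: outer_def)
qed

lemma kind_between: "w \<in> kind i \<Longrightarrow> w \<in> inner \<Longrightarrow> w \<in> between"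
proof -
  assume w: "w \<in> kind i" "w \<in> inner"
  have "w \<notin> III \<mu>"
    using w(1) III_octant not_octant unfolding kind_def cyl_minus_iff II_bar_iff Un_iff III_iff by blast
  then show ?thesis using inner_cases[OF w(2)] by blast
qed

section \<open>Passing between outer regions and labelled cells\<close>

lemma adjacent_coordinates:
  assumes "cell_adjacent w w'"
  obtains i e where "e = 1 \<or> e = -1" "w' $ i = w $ i + e" "\<And>j. j \<noteq> i \<Longrightarrow> w' $ j = w $ j"
proof -
  obtain i where "w' = w + axis i 1 \<or> w' = w - axis i 1" using assms unfolding cell_adjacent_def by blast
  then show thesis using that[of 1 i] that[of "-1" i] by (auto simp: axis_def)
qed

text \<open>A single step changes one coordinate, so it cannot make one coordinate nonnegative and
  another one negative.\<close>

lemma adjacent_outer: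
  assumes "w \<in> outer i" "w' \<in> outer j" "cell_adjacent w w'"
  shows "i = j"
proof (rule ccontr)
  assume "i \<noteq> j"
  then have "w $ i < 0" "0 \<le> w' $ i" "0 \<le> w $ j" "w' $ j < 0" using assms(1,2) unfolding outer_def by auto
  moreover obtain k e where "e = 1 \<or> e = -1" "w' $ k = w $ k + e" "\<And>j. j \<noteq> k \<Longrightarrow> w' $ j = w $ j"
    using adjacent_coordinates[OF assms(3)] by metis
  ultimately show False using \<open>i \<noteq> j\<close> by (metis not_le)
qed

text \<open>The new cell either keeps coordinate \<open>i\<close> as its negative one and then lies
  in \<open>cyl_minus \<mu> i\<close>, or it enters the octant along axis \<open>i\<close>. In that
  case it is still outside \<open>cyl \<mu> i\<close>, which leaves only
  \<open>II_bar \<mu> i\<close>.\<close>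

lemma adjacent_outer_inner:
  assumes w: "w \<in> outer i" and w': "w' \<in> inner" "w' \<in> between" and "cell_adjacent w w'"
  shows "w' \<in> kind i"
proof -
  obtain k e where k: "e = 1 \<or> e = -1" "w' $ k = w $ k + e" "\<And>j. j \<noteq> k \<Longrightarrow> w' $ j = w $ j"
    using adjacent_coordinates[OF assms(4)] by metis
  have neg: "w $ i < 0" and nonneg: "\<And>j. j \<noteq> i \<Longrightarrow> 0 \<le> w $ j" and out: "w \<notin> cyl \<mu> i"
    using w unfolding outer_def by auto
  show ?thesis
  proof (cases "w' \<in> octant")
    case False
    then have "w' \<in> I_minus \<mu>" using w'(1) II_octant III_octant unfolding inner_def by blast
    then obtain l where l: "w' \<in> cyl \<mu> l" "w' $ l < 0" unfolding I_minus_iff by blast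
    have "l = i"
    proof (rule ccontr)
      assume "l \<noteq> i"
      then have "0 \<le> w $ l" "0 \<le> w' $ i" using nonneg cyl_nonneg[OF l(1)] by auto
      then show False using neg l(2) k(3) \<open>l \<noteq> i\<close> by (metis not_le)
    qed
    then show ?thesis using l by (simp add: kind_def cyl_minus_iff)
  next
    case True
    then have "k = i" using neg k(3) unfolding octant_iff by (metis not_le)
    then have "w' $ (i + 1) = w $ (i + 1)" "w' $ (i + 2) = w $ (i + 2)" using k(3) by auto
    then have "w' \<notin> cyl \<mu> i" using out by (simp add: cyl_iff)
    then have "w' \<notin> III \<mu>" unfolding III_iff by blast
    then have "w' \<in> II \<mu>" using w'(1) octant_not_I_minus[OF True] unfolding inner_def by blast
    then obtain l where "w' \<in> II_bar \<mu> l" unfolding II_iff by blast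
    moreover from this have "l = i" using index_eq_cases[of i l] \<open>w' \<notin> cyl \<mu> i\<close> unfolding II_bar_iff by auto
    ultimately show ?thesis unfolding kind_def by blast
  qed
qed

text \<open>The complement of a Young diagram in the quadrant is closed upwards.\<close>

lemma outer_up:
  assumes "w \<in> outer i" "w' $ i < 0" "\<And>j. j \<noteq> i \<Longrightarrow> w $ j \<le> w' $ j"
  shows "w' \<in> outer i"
proof -
  have "0 \<le> w' $ j" if "j \<noteq> i" for j using assms(1) assms(3)[OF that] that unfolding outer_def by fastforce
  moreover have "w' \<notin> cyl \<mu> i"
  proof
    assume "w' \<in> cyl \<mu> i"
    then have "w \<in> cyl \<mu> i"
      using assms(1,3) partition[of i] unfolding cyl_iff outer_def
      by (elim young_diagram_down[rotated]) auto
    then show False using assms(1) by (simp add: outer_def)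
  qed
  ultimately show ?thesis using assms(2) by (simp add: outer_def)
qed

lemma kind_linked_outer:
  assumes "w \<in> kind i" "w \<in> inner"
  obtains v where "v \<in> outer i" "linked v w"
proof -
  have w: "w \<in> between" using kind_between assms by blast
  consider "w \<in> cyl_minus \<mu> i" | "w \<in> II_bar \<mu> i" using assms unfolding kind_def by blast
  then show thesis
  proof cases
    case 1
    then have c: "w \<in> cyl \<mu> i" "w $ i < 0" by (auto simp: cyl_minus_iff)
    \<comment> \<open>Going up far enough in the two transverse directions leaves the
      cylinder.\<close>
    define v where "v = (\<chi> j. if j = i then w $ j else w $ j + size_bound)"
    have "v \<notin> cyl \<mu> i" using cyl_bound[of v i "i + 1"] cyl_nonneg[OF c(1), of "i + 1"] by (auto simp: v_def)
    then have v: "v \<in> outer i"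
      using c cyl_nonneg[OF c(1)] size_bound_nonneg unfolding outer_def by (auto simp: v_def)
    have "w $ j \<le> v $ j" for j using size_bound_nonneg by (simp add: v_def)
    then have "linked w v" using linked_le w v outer_between unfolding between_def by blast
    then show thesis using that v linked_sym by blast
  next
    case 2
    \<comment> \<open>Membership in \<open>cyl \<mu> i\<close> does not depend on coordinate
      \<open>i\<close>, so the cell just below the octant in this direction is in N_i.\<close>
    define v where "v = (\<chi> j. if j = i then -1 else w $ j)"
    have oct: "w \<in> octant" using 2 II_octant unfolding II_iff by blast
    have "v \<notin> cyl \<mu> i" using 2 by (simp add: v_def cyl_iff II_bar_iff)
    then have v: "v \<in> outer i" using oct unfolding outer_def octant_iff by (auto simp: v_def)
    have "v $ j \<le> w $ j" for j using oct[unfolded octant_iff, THEN spec, of j] by (auto simp: v_def)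
    then have "linked v w" using linked_le w v outer_between unfolding between_def by blast
    then show thesis using that v by blast
  qed
qed

text \<open>Adjacent cells are comparable, and a down-closed set containing the larger one contains
  the smaller one. Hence the cells of III in \<open>B - A\<close> never connect cells of
  \<open>between\<close> inside \<open>inner\<close>.\<close>

lemma not_adjacent_across:
  assumes "w \<in> between" "w' \<in> U_A \<mu> A - U_B \<mu> B"
  shows "\<not> cell_adjacent w w'"
proof
  assume "cell_adjacent w w'"
  then obtain i where "w' = w + axis i 1 \<or> w' = w - axis i 1" unfolding cell_adjacent_def by blast
  then have "(\<forall>j. w $ j \<le> w' $ j) \<or> (\<forall>j. w' $ j \<le> w $ j)"
    by (elim disjE) (simp_all add: axis_def)
  then show False
    using assms surface_down[OF surface_U_A, of w' w] surface_down[OF surface_U_B, of w w'] unfolding between_def by blast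
qed

section \<open>Components of \<open>inner\<close> and of \<open>between\<close>\<close>

definition inner_linked :: "(cell \<times> cell) set" where
  "inner_linked = {(w, w'). w \<in> inner \<and> w' \<in> inner \<and> cell_adjacent w w'}\<^sup>*"

lemma inner_linked_sym: "(w, w') \<in> inner_linked \<Longrightarrow> (w', w) \<in> inner_linked"
proof -
  have "sym {(w, w'). w \<in> inner \<and> w' \<in> inner \<and> cell_adjacent w w'}"
    by (auto simp: sym_def cell_adjacent_sym)
  then show "(w, w') \<in> inner_linked \<Longrightarrow> (w', w) \<in> inner_linked"
    unfolding inner_linked_def by (meson sym_rtrancl symD)
qed

lemma inner_linked_trans: "(w, w') \<in> inner_linked \<Longrightarrow> (w', w'') \<in> inner_linked \<Longrightarrow> (w, w'') \<in> inner_linked"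
  unfolding inner_linked_def by (rule rtrancl_trans)

lemma labelled_iff_inner_linked:
  "labelled_AB_configuration \<mu> A B \<longleftrightarrow>
    (\<forall>i j. \<forall>w\<in>inner \<inter> kind i. \<forall>w'\<in>inner \<inter> kind j. (w, w') \<in> inner_linked \<longrightarrow> i = j)"
proof -
  have eq: "cell_components inner = inner // (inner_linked \<inter> inner \<times> inner)"
    unfolding cell_components_def inner_linked_def ..
  have lab: "labelled_AB_configuration \<mu> A B \<longleftrightarrow> \<not> (\<exists>C\<in>inner // (inner_linked \<inter> inner \<times> inner).
      \<exists>i j. i \<noteq> j \<and> C \<inter> kind i \<noteq> {} \<and> C \<inter> kind j \<noteq> {})"
    unfolding labelled_AB_configuration_def using AB by (simp flip: inner_def kind_def eq)
  show ?thesis unfolding lab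
  proof (intro iffI notI allI ballI impI)
    fix i j w w'
    assume no: "\<not> (\<exists>C\<in>inner // (inner_linked \<inter> inner \<times> inner).
      \<exists>i j. i \<noteq> j \<and> C \<inter> kind i \<noteq> {} \<and> C \<inter> kind j \<noteq> {})"
      and w: "w \<in> inner \<inter> kind i" "w' \<in> inner \<inter> kind j" "(w, w') \<in> inner_linked"
    define C where "C = (inner_linked \<inter> inner \<times> inner) `` {w}"
    have "(w, w) \<in> inner_linked" unfolding inner_linked_def by simp
    then have "C \<inter> kind i \<noteq> {}" "C \<inter> kind j \<noteq> {}" using w unfolding C_def by auto
    moreover have "C \<in> inner // (inner_linked \<inter> inner \<times> inner)" using w unfolding C_def by (intro quotientI) blast
    ultimately show "i = j" using no by meson
  next
    assume all: "\<forall>i j. \<forall>w\<in>inner \<inter> kind i. \<forall>w'\<in>inner \<inter> kind j. (w, w') \<in> inner_linked \<longrightarrow> i = j"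
      and "\<exists>C\<in>inner // (inner_linked \<inter> inner \<times> inner). \<exists>i j. i \<noteq> j \<and> C \<inter> kind i \<noteq> {} \<and> C \<inter> kind j \<noteq> {}"
    then obtain C i j w w' where C: "C \<in> inner // (inner_linked \<inter> inner \<times> inner)" "i \<noteq> j"
      and w: "w \<in> C" "w \<in> kind i" "w' \<in> C" "w' \<in> kind j" by blast
    then obtain v where "C = (inner_linked \<inter> inner \<times> inner) `` {v}" by (auto elim: quotientE)
    then have "(v, w) \<in> inner_linked" "(v, w') \<in> inner_linked" "w \<in> inner" "w' \<in> inner" using w by auto
    then have "(w, w') \<in> inner_linked" using inner_linked_sym inner_linked_trans by blast
    then show False using all w C(2) \<open>w \<in> inner\<close> \<open>w' \<in> inner\<close> by blast
  qed
qed

lemma inner_linked_between: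
  assumes "(w, w') \<in> inner_linked" "w \<in> between"
  shows "linked w w' \<and> w' \<in> between"
  using assms(1) unfolding inner_linked_def
proof (induction rule: rtrancl_induct)
  case (step v v')
  then have "v' \<in> between" using inner_cases[of v'] not_adjacent_across[of v v'] by auto
  moreover from this have "linked v v'"
    using step unfolding linked_def between_def by (intro r_into_rtrancl) auto
  ultimately show ?case using step.IH linked_trans by blast
qed (use assms in simp)

text \<open>A walk in V leaves N_i and enters N_j only through cells labelled \<open>i\<close> and
  \<open>j\<close> (\<open>adjacent_outer_inner\<close>); conversely, every labelled cell of
  \<open>inner\<close> is linked to the region of its label
  (\<open>kind_linked_outer\<close>).\<close>

lemma labelled_iff_outer_separated:
  "labelled_AB_configuration \<mu> A B \<longleftrightarrow>
    (\<forall>i j. \<forall>w\<in>outer i. \<forall>w'\<in>outer j. linked w w' \<longrightarrow> i = j)"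
proof
  assume lab: "labelled_AB_configuration \<mu> A B"
  show "\<forall>i j. \<forall>w\<in>outer i. \<forall>w'\<in>outer j. linked w w' \<longrightarrow> i = j"
  proof (intro allI ballI impI)
    fix i j w w' assume w: "w \<in> outer i" and w': "w' \<in> outer j" and l: "linked w w'"
    \<comment> \<open>The invariant of the walk: it is in N_i or in a component of
      \<open>inner\<close> that contains a cell labelled \<open>i\<close>.\<close>
    have "w' \<in> outer i \<or> w' \<in> inner \<and> (\<exists>y\<in>inner \<inter> kind i. (y, w') \<in> inner_linked)"
      using l unfolding linked_def
    proof (induction rule: rtrancl_induct)
      case (step x x')
      then have x': "x' \<in> between" and x: "x \<in> between" and adj: "cell_adjacent x x'" by (auto simp: between_def)
      show ?case
      proof (cases "x' \<in> inner")
        case True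
        show ?thesis
        proof (cases "x \<in> outer i")
          case x_outer: True
          then have "x' \<in> kind i" using adjacent_outer_inner True x' adj by blast
          moreover have "(x', x') \<in> inner_linked" by (simp add: inner_linked_def)
          ultimately show ?thesis using True by blast
        next
          case False
          then obtain y where "x \<in> inner" "y \<in> inner \<inter> kind i" "(y, x) \<in> inner_linked" using step.IH by blast
          moreover have "(x, x') \<in> inner_linked"
            unfolding inner_linked_def using adj True \<open>x \<in> inner\<close> by blast
          ultimately show ?thesis using True inner_linked_trans by blast
        qed
      next
        case False
        then obtain l where l: "x' \<in> outer l" using between_cases x' by blast
        show ?thesis
        proof (cases "x \<in> outer i")
          case True
          then show ?thesis using adjacent_outer[OF True l adj] l by blast
        next
          case False
          then obtain y where y: "x \<in> inner" "y \<in> inner \<inter> kind i" "(y, x) \<in> inner_linked" using step.IH by blast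
          have "x \<in> kind l" using adjacent_outer_inner[OF l \<open>x \<in> inner\<close> x] adj cell_adjacent_sym by blast
          then have "i = l" using lab y unfolding labelled_iff_inner_linked by blast
          then show ?thesis using l by blast
        qed
      qed
    qed (use w in simp)
    then have "w' \<in> outer i" using outer_not_inner[OF w'] by blast
    then show "i = j" using w' unfolding outer_def by (metis (mono_tags, lifting) mem_Collect_eq not_le)
  qed
next
  assume sep: "\<forall>i j. \<forall>w\<in>outer i. \<forall>w'\<in>outer j. linked w w' \<longrightarrow> i = j"
  show "labelled_AB_configuration \<mu> A B"
    unfolding labelled_iff_inner_linked
  proof (intro allI ballI impI)
    fix i j w w' assume w: "w \<in> inner \<inter> kind i" "w' \<in> inner \<inter> kind j" "(w, w') \<in> inner_linked"
    obtain v where v: "v \<in> outer i" "linked v w" using kind_linked_outer w(1) by blast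
    obtain v' where v': "v' \<in> outer j" "linked v' w'" using kind_linked_outer w(2) by blast
    have "linked w w'" using inner_linked_between w(1,3) kind_between by blast
    then have "linked v v'" using v v' linked_trans linked_sym by blast
    then show "i = j" using sep v v' by blast
  qed
qed

lemma outer_connected:
  assumes "w \<in> outer i" "w' \<in> outer i"
  shows "linked w w'"
proof -
  \<comment> \<open>A meeting cell for \<open>w\<close> and \<open>w'\<close>: lower in direction
    \<open>i\<close> and higher in the two others, which does not leave N_i.\<close>
  define v where "v = (\<chi> j. if j = i then min (w $ j) (w' $ j) else max (w $ j) (w' $ j))"
  have "linked x v" if "x \<in> outer i" "x = w \<or> x = w'" for x
  proof -
    \<comment> \<open>An intermediate cell comparable with both \<open>x\<close> and
      \<open>v\<close>, so that \<open>linked_le\<close> applies twice.\<close>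
    define y where "y = (\<chi> j. if j = i then x $ j else v $ j)"
    have xv: "x $ j \<le> v $ j" if "j \<noteq> i" for j using that \<open>x = w \<or> x = w'\<close> by (auto simp: v_def)
    have vi: "v $ i \<le> x $ i" using \<open>x = w \<or> x = w'\<close> by (auto simp: v_def)
    have xi: "x $ i < 0" using that(1) by (simp add: outer_def)
    have y: "y \<in> outer i" using outer_up[OF that(1), of y] xv xi by (simp add: y_def)
    have v: "v \<in> outer i" using outer_up[OF that(1), of v] xv vi xi by simp
    have "linked x y" using that(1) y outer_between xv
      by (intro linked_le) (auto simp: between_def y_def)
    moreover have "linked v y" using v y outer_between vi
      by (intro linked_le) (auto simp: between_def y_def)
    ultimately show ?thesis using linked_trans linked_sym by blast
  qed
  then show ?thesis using assms linked_trans linked_sym by blast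
qed

lemma finite_inner: "finite inner"
proof -
  have "inner \<subseteq> A \<union> (II \<mu> \<union> III \<mu>)" unfolding inner_def by blast
  then show ?thesis using finite_A finite_II_III by (meson finite_UnI finite_subset)
qed

end

subsection \<open>Labelled configurations and sectors of paths\<close>

text \<open>This turns a condition on both ends of a path into one finiteness statement, which
  injectivity of the path can supply.\<close>

lemma finite_failures_iff_eventually:
  fixes P :: "int \<Rightarrow> bool"
  shows "finite {n. \<not> P n} \<longleftrightarrow> eventually P at_bot \<and> eventually P at_top"
proof
  assume fin: "finite {n. \<not> P n}"
  obtain a where a: "\<And>n. \<not> P n \<Longrightarrow> n \<le> a" using bdd_above_finite[OF fin] unfolding bdd_above_def by blast
  obtain b where b: "\<And>n. \<not> P n \<Longrightarrow> b \<le> n" using bdd_below_finite[OF fin] unfolding bdd_below_def by blast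
  have "eventually P at_top" using eventually_gt_at_top[of a] by eventually_elim (use a in force)
  moreover have "eventually P at_bot"
    unfolding eventually_at_bot_linorder using b by (intro exI[of _ "b - 1"]) force
  ultimately show "eventually P at_bot \<and> eventually P at_top" by blast
next
  assume "eventually P at_bot \<and> eventually P at_top"
  then obtain a b where "\<And>n. n \<le> a \<Longrightarrow> P n" "\<And>n. n \<ge> b \<Longrightarrow> P n"
    unfolding eventually_at_bot_linorder eventually_at_top_linorder by blast
  then have "{n. \<not> P n} \<subseteq> {a..b}" by (auto simp: not_le) (meson linear)+
  then show "finite {n. \<not> P n}" by (rule finite_subset) simp
qed

context two_surfaces begin

lemma alternating_prev:
  fixes F :: "int \<Rightarrow> node"
  assumes "\<And>n. F (n + 1) = (if even n then turn_U (F n) else turn_W (F n))"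
  shows "F (n - 1) = (if even n then turn_W (F n) else turn_U (F n))"
  using assms[of "n - 1"] by auto

lemma alternating_closed:
  fixes F :: "int \<Rightarrow> node"
  assumes F: "\<And>n. F (n + 1) = (if even n then turn_U (F n) else turn_W (F n))"
    and "s \<in> range F" "gap (head s i) \<noteq> gap (tail s i)"
  shows "nb s i \<in> range F"
proof -
  obtain n where n: "s = F n" using assms(2) by blast
  have "dir U s = i \<or> dir W s = i" using gap_diff[of s i] assms(3)
    by (cases "dir U s = i"; cases "dir W s = i") simp_all
  then have "nb s i = turn_U s \<or> nb s i = turn_W s" by blast
  then have "nb s i = F (n + 1) \<or> nb s i = F (n - 1)"
    using F[of n] alternating_prev[OF F, of n] unfolding n by (cases "even n") auto
  then show ?thesis by blast
qed

lemma alternating_single: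
  fixes F :: "int \<Rightarrow> node"
  assumes F: "\<And>n. F (n + 1) = (if even n then turn_U (F n) else turn_W (F n))" and "single (F 0)"
  shows "single (F n)"
proof (induction n rule: int_induct[of _ 0])
  case (step1 n)
  then show ?case using F[of n] single_turn[of "F n"] by (cases "even n") auto
next
  case (step2 n)
  then show ?case using alternating_prev[OF F, of n] single_turn[of "F n"] by (cases "even n") auto
qed (rule assms)

lemma height_eqI:
  assumes "surface S" "v \<in> S" "(\<chi> l. v $ l + 1) \<notin> S"
  shows "height S (line v) = v $ 3 + 1"
proof -
  have "line (\<chi> l. v $ l + 1) = line v" by (simp add: line_def)
  then show ?thesis using assms(2,3) in_surface_iff[OF assms(1), of v] in_surface_iff[OF assms(1), of "\<chi> l. v $ l + 1"]
    by simp
qed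

end

context AB_pair begin

lemma double_dimer_pos: "double_dimer \<mu> A B e > 0 \<longleftrightarrow> e \<in> dimers (U_A \<mu> A) \<or> e \<in> dimers (U_B \<mu> B)"
  by (simp add: double_dimer_def)

text \<open>\<open>U_B\<close> contains everything outside the octant, and inside it
  \<open>U_A\<close> has only cells of III. So the gap is positive over finitely many lattice points
  only.\<close>

lemma gap_pos_in_III: "gap P > 0 \<Longrightarrow> P \<in> line ` III \<mu>"
proof -
  assume "gap P > 0"
  then obtain w where w: "w \<in> U_A \<mu> A" "w \<notin> U_B \<mu> B" "line w = P" using gap_pos_iff by blast
  then have oct: "w \<in> octant" unfolding U_B_def by blast
  then have "w \<in> III \<mu>"
    using w(1) octant_not_I_minus[OF oct] not_octant unfolding U_A_def by blast
  then show ?thesis using w(3) by blast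
qed

lemma same_sector_if_labelled:
  assumes lab: "labelled_AB_configuration \<mu> A B" and f: "bi_infinite_path (double_dimer \<mu> A B) f"
  shows "starts_and_ends_in_same_sector f"
proof -
  obtain F where F: "\<And>n. f n = tri (F n)" "inj F" "\<And>n. F (n + 1) \<in> {turn_U (F n), turn_W (F n)}" "\<And>n. single (F n)"
    using bi_infinite_path_nodes[OF double_dimer_pos f] by metis
  have level: "same_level (F 0) (F n)" for n using same_level_path[of F n] F(3,4) by blast
  have fin: "finite (F -` X)" if "finite X" for X using finite_vimageI[OF that F(2)] .
  \<comment> \<open>Otherwise the upper side of the path has positive gap everywhere, and infinitely
    many nodes touch the finite projection of III.\<close>
  have neg: "gap (low (F n)) < 0" for n
  proof (rule ccontr)
    assume "\<not> gap (low (F n)) < 0"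
    then have "gap (low (F m)) \<ge> 0" for m using level[of n] level[of m] unfolding same_level_def by simp
    then have "gap (tail (F m) (dir (U_A \<mu> A) (F m))) > 0" for m
      using gap_corners(1)[OF F(4)[of m]] by (metis less_add_one order_le_less_trans)
    then have "F m \<in> {s. \<exists>i. tail s i \<in> line ` III \<mu>}" for m using gap_pos_in_III by blast
    then have "UNIV = F -` {s. \<exists>i. tail s i \<in> line ` III \<mu>}" by blast
    moreover have "finite (line ` III \<mu>)" using finite_II_III by simp
    ultimately have "finite (UNIV :: int set)" using fin finite_tails by metis
    then show False using infinite_UNIV_int by blast
  qed
  have linked_low: "linked (rep (low (F n))) (rep (low (F m)))" for n m
    using level[of n] level[of m] neg linked_trans linked_sym unfolding same_level_def by metis
  \<comment> \<open>Positions at which the path touches the finite projection of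
    \<open>inner\<close>; elsewhere its lower side meets outer regions only.\<close>
  define bad where "bad = F -` {s. \<exists>i. head s i \<in> line ` inner}"
  have "finite bad" unfolding bad_def using finite_inner by (intro fin finite_heads) simp
  have far: "\<exists>i w. w \<in> outer i \<and> linked (rep (low (F n))) w \<and> tri (F n) \<subseteq> sector i" if "n \<notin> bad" for n
  proof -
    obtain w where w: "w \<in> between" "line w = low (F n)"
      using neg[of n] gap_neg_iff unfolding between_def by blast
    have "w \<notin> inner"
      using that w(2) unfolding bad_def low_def by (metis (mono_tags, lifting) imageI mem_Collect_eq vimageI)
    then obtain i where i: "w \<in> outer i" using between_cases[OF w(1)] by blast
    obtain j where j: "tri (F n) \<subseteq> sector j" using tri_in_some_sector by blast
    have "real_pt (line w) \<in> sector j" using j head_in_tri unfolding w(2) low_def by blast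
    \<comment> \<open>In sector \<open>j\<close> coordinate \<open>j\<close> is minimal, while
      \<open>i\<close> is the only negative coordinate of \<open>w\<close>.\<close>
    then have "w $ j \<le> w $ i" unfolding line_in_sector by blast
    then have "j = i" using i unfolding outer_def by fastforce
    moreover have "linked (rep (low (F n))) w" using linked_rep[of w] w unfolding between_def by simp
    ultimately show ?thesis using i j by blast
  qed
  obtain n0 where "n0 \<notin> bad" using \<open>finite bad\<close> infinite_UNIV_int by (metis ex_new_if_finite)
  then obtain i w where i: "w \<in> outer i" "linked (rep (low (F n0))) w" using far by blast
  have "tri (F n) \<subseteq> sector i" if n: "n \<notin> bad" for n
  proof -
    obtain j v where j: "v \<in> outer j" "linked (rep (low (F n))) v" "tri (F n) \<subseteq> sector j" using far[OF n] by blast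
    have "linked w v" using i(2) j(2) linked_low[of n0 n] linked_trans linked_sym by blast
    then have "i = j" using lab i(1) j(1) unfolding labelled_iff_outer_separated by blast
    then show ?thesis using j by simp
  qed
  then have "{n. \<not> f n \<subseteq> sector i} \<subseteq> bad" unfolding F(1) by blast
  then have "finite {n. \<not> f n \<subseteq> sector i}" using \<open>finite bad\<close> finite_subset by blast
  then show ?thesis unfolding finite_failures_iff_eventually starts_and_ends_in_same_sector_def by blast
qed

section \<open>The gap far out along the rays\<close>

definition ray :: "3 \<Rightarrow> int \<Rightarrow> int \<times> int" where
  "ray k m = line (\<chi> l. if l = k then m else 0)"

text \<open>For \<open>i \<noteq> k\<close> and with \<open>j\<close> the third index, this cell
  lies on the line \<open>ray k m + step j\<close>, which for large \<open>m\<close> is a neighbour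
  of the ray inside sector \<open>i\<close>.\<close>

definition ray_cell :: "3 \<Rightarrow> 3 \<Rightarrow> int \<Rightarrow> cell" where
  "ray_cell k i m = (\<chi> l. if l = k then m - 1 else if l = i then -1 else 0)"

lemma far_not_cyl: "size_bound \<le> w $ k \<Longrightarrow> l \<noteq> k \<Longrightarrow> w \<notin> cyl \<mu> l"
  using cyl_bound[of w l k] by auto

lemma far_not_II_III: "size_bound \<le> w $ k \<Longrightarrow> w \<notin> II \<mu> \<union> III \<mu>"
  unfolding II_III_iff using far_not_cyl by (metis index_add_distinct(3))

lemma octant_not_in_U:
  assumes "w \<in> octant" "w \<notin> II \<mu> \<union> III \<mu>"
  shows "w \<notin> U_A \<mu> A" "w \<notin> U_B \<mu> B"
proof -
  have "w \<notin> I_minus \<mu> \<union> III \<mu>" using octant_not_I_minus[OF assms(1)] assms(2) by blast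
  then show "w \<notin> U_A \<mu> A" using assms(1) unfolding octant_iff by (intro not_in_U_A[of w 1]) auto
  show "w \<notin> U_B \<mu> B" using assms unfolding U_B_def by blast
qed

lemma ray_cell_outer:
  assumes "i \<noteq> k" "size_bound < m"
  shows "ray_cell k i m \<in> outer i"
proof -
  have "ray_cell k i m \<notin> cyl \<mu> i" using assms by (intro far_not_cyl[of _ k]) (auto simp: ray_cell_def)
  then show ?thesis using assms size_bound_nonneg unfolding outer_def by (auto simp: ray_cell_def)
qed

lemma line_ray_cell: "i \<noteq> j \<Longrightarrow> i \<noteq> k \<Longrightarrow> j \<noteq> k \<Longrightarrow> line (ray_cell k i m) = ray k m + step j"
  unfolding ray_def ray_cell_def
  by (cases i rule: index_cases; cases j rule: index_cases; cases k rule: index_cases)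
    (simp_all add: line_def step_def)

text \<open>Both sets stop at the same place on this line: after a cell with two negative
  coordinates, which is in both, comes a cell of the octant beyond II and III, which is in
  neither.\<close>

lemma gap_ray:
  assumes "size_bound < m"
  shows "gap (ray k m) = 0"
proof -
  define v :: cell where "v = (\<chi> l. if l = k then m - 1 else -1)"
  have v1: "(\<chi> l. v $ l + 1) = (\<chi> l. if l = k then m else 0)" (is "_ = ?w") by (simp add: v_def vec_eq_iff)
  have line_v: "line v = ray k m" unfolding ray_def v_def by (cases k rule: index_cases) (simp_all add: line_def)
  have neg: "v $ (k + 1) < 0" "v $ (k + 2) < 0" by (simp_all add: v_def)
  have "?w \<in> octant" using assms size_bound_nonneg by (simp add: octant_iff)
  moreover have "?w \<notin> II \<mu> \<union> III \<mu>" using assms by (intro far_not_II_III[of _ k]) simp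
  ultimately have "?w \<notin> U_A \<mu> A" "?w \<notin> U_B \<mu> B" by (rule octant_not_in_U)+
  moreover have "v \<in> U_A \<mu> A" "v \<in> U_B \<mu> B"
    using neg not_octant[OF neg(1)] index_add_distinct(3) unfolding U_A_def U_B_def by blast+
  ultimately have "height (U_A \<mu> A) (line v) = v $ 3 + 1" "height (U_B \<mu> B) (line v) = v $ 3 + 1"
    using height_eqI[OF surface_U_A, of v] height_eqI[OF surface_U_B, of v] unfolding v1 by blast+
  then show ?thesis by (simp add: gap_def line_v)
qed

text \<open>Exactly one cell of V lies on this line: the cell before it has two negative coordinates
  and is in \<open>U_A\<close>, the cell after it is in the octant beyond II and III and so not in
  \<open>U_B\<close>.\<close>

lemma gap_beside_ray:
  assumes "size_bound < m" "i \<noteq> k"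
  shows "gap (line (ray_cell k i m)) = -1"
proof -
  let ?v = "ray_cell k i m"
  define u :: cell where "u = (\<chi> l. ?v $ l - 1)"
  have u1: "(\<chi> l. u $ l + 1) = ?v" by (simp add: u_def vec_eq_iff)
  have line_u: "line u = line ?v" by (simp add: u_def line_def)
  have v: "?v \<in> between" using ray_cell_outer assms outer_between by blast
  obtain j where j: "j \<noteq> i" "j \<noteq> k" by (metis index_add_distinct(4,5,6))
  have neg: "u $ i < 0" "u $ j < 0" using assms j by (simp_all add: u_def ray_cell_def)
  have "u \<in> U_A \<mu> A" using neg j unfolding U_A_def by blast
  then have "height (U_A \<mu> A) (line ?v) = ?v $ 3"
    using height_eqI[OF surface_U_A, of u] v unfolding u1 line_u between_def by (simp add: u_def)
  moreover have "(\<chi> l. ?v $ l + 1) \<notin> U_B \<mu> B"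
  proof -
    have "(\<chi> l. ?v $ l + 1) \<notin> II \<mu> \<union> III \<mu>"
      using assms by (intro far_not_II_III[of _ k]) (simp add: ray_cell_def)
    moreover have "(\<chi> l. ?v $ l + 1) \<in> octant"
      using assms size_bound_nonneg by (auto simp: octant_iff ray_cell_def)
    ultimately show ?thesis unfolding U_B_def by blast
  qed
  then have "height (U_B \<mu> B) (line ?v) = ?v $ 3 + 1"
    using height_eqI[OF surface_U_B, of ?v] v unfolding between_def by blast
  ultimately show ?thesis by (simp add: gap_def)
qed

lemma ray_inj: "ray k m = ray k n \<longleftrightarrow> m = n"
  unfolding ray_def by (cases k rule: index_cases) (auto simp: line_def)

text \<open>Triangles beside the ray between sectors \<open>i\<close> and \<open>i + 1\<close>, on
  the side of sector \<open>i\<close>. Crossing edge \<open>i\<close> and then edge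
  \<open>i + 1\<close> leads to the next one; both edges join a point of the ray to one beside
  it.\<close>

lemma ray_node_corners:
  fixes i :: 3
  defines "T m \<equiv> node_at False i (ray (i + 2) m)"
  shows "tail (T m) i = ray (i + 2) (m + 1) + step (i + 1)"
    "head (T m) (i + 1) = ray (i + 2) m + step (i + 1)" "tail (T m) (i + 1) = ray (i + 2) m"
    "nb (nb (T m) i) (i + 1) = T (m + 1)"
  unfolding T_def ray_def tail_def
  by (cases i rule: index_cases; simp add: line_def step_def index_mod_3)+

text \<open>In the application \<open>Z\<close> is the set of nodes of one path. The gap differences
  at its nodes form a closed 1-form, integrated by \<open>closed_form_exact\<close>. Along a step
  between cells of V the gap is negative at both ends, hence -1 at both on this level, so the
  potential does not change.\<close>

lemma component_potential:
  assumes Z: "\<And>s i. s \<in> Z \<Longrightarrow> gap (head s i) \<noteq> gap (tail s i) \<Longrightarrow> nb s i \<in> Z"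
    and level: "\<And>s i. s \<in> Z \<Longrightarrow> gap (head s i) \<in> {-1, 0} \<and> gap (tail s i) \<in> {-1, 0}"
  obtains g where "\<And>s i. g (head s i) - g (tail s i) = of_bool (s \<in> Z) * (gap (head s i) - gap (tail s i))"
    "\<And>w w'. linked w w' \<Longrightarrow> g (line w) = g (line w')"
proof -
  define c where "c s i = of_bool (s \<in> Z) * (gap (head s i) - gap (tail s i))" for s i
  \<comment> \<open>Where the gap changes across an edge, \<open>Z\<close> contains both of its
    nodes or neither.\<close>
  have "c (nb s i) i = c s i" for s i
    using Z[of s i] Z[of "nb s i" i] unfolding c_def by (cases "gap (head s i) = gap (tail s i)") auto
  moreover have "c s 1 + c s 2 + c s 3 = 0" for s
    using sum_around_node[of gap s] by (simp add: c_def sum_3)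
  ultimately obtain g where g: "\<And>s i. g (head s i) - g (tail s i) = c s i"
    using closed_form_exact[of c] by blast
  have g_step: "g (line (w + axis i 1)) = g (line w)" if "w \<in> between" "w + axis i 1 \<in> between" for w i
  proof -
    define s where "s = node_at False i (line w + step i)"
    have ht: "head s i = line (w + axis i 1)" "tail s i = line w" by (simp_all add: s_def tail_def)
    have "gap (head s i) < 0" "gap (tail s i) < 0"
      unfolding ht using that gap_neg_iff unfolding between_def by blast+
    then have "c s i = 0" using level[of s i] unfolding c_def by auto
    then show ?thesis using g[of s i] unfolding ht by simp
  qed
  have "g (line w) = g (line w')" if "linked w w'" for w w'
    using that unfolding linked_def
  proof (induction rule: rtrancl_induct)
    case (step x y)
    then have x: "x \<in> between" "y \<in> between" "cell_adjacent x y" by (auto simp: between_def)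
    then obtain l where "y = x + axis l 1 \<or> x = y + axis l 1"
      unfolding cell_adjacent_def by (metis diff_add_cancel)
    then have "g (line y) = g (line x)" using g_step[of x l] g_step[of y l] x by auto
    then show ?case using step.IH by simp
  qed simp
  then show thesis using that g unfolding c_def by blast
qed

text \<open>
  The component that starts out along the ray between sectors \<open>i\<close> and \<open>i + 1\<close> on the side of sector
  \<open>i\<close> returns to sector \<open>i\<close> by assumption. Hence far out on this ray its potential jumps towards
  sector \<open>i\<close> but not towards sector \<open>i + 1\<close>.
\<close>

lemma neighbouring_sectors_separated:
  assumes sect: "\<And>f. bi_infinite_path (double_dimer \<mu> A B) f \<Longrightarrow> starts_and_ends_in_same_sector f"
    and w: "w \<in> outer i" "w' \<in> outer (i + 1)"
  shows "\<not> linked w w'"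
proof
  assume "linked w w'"
  \<comment> \<open>From \<open>M\<close> on, the gap is 0 on the ray and -1 beside it.\<close>
  define M where "M = size_bound + 1"
  define T where "T m = node_at False i (ray (i + 2) m)" for m
  note corners = ray_node_corners[of i, folded T_def]
  have head_T: "head (T m) i = ray (i + 2) m" for m by (simp add: T_def)
  have near: "gap (ray (i + 2) m + step (i + 1)) = -1" if "m \<ge> M" for m
    using gap_beside_ray[of m i "i + 2"] line_ray_cell[of i "i + 1" "i + 2" m] that by (simp add: M_def)
  have on: "gap (ray (i + 2) m) = 0" if "m \<ge> M" for m
    using gap_ray that by (simp add: M_def)
  obtain F where F0: "F (0::int) = T M"
    and F: "\<And>n. F (n + 1) = (if even n then turn_U (F n) else turn_W (F n))"
    using alternating_orbit by metis
  note closed = alternating_closed[OF F]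
  \<comment> \<open>The orbit follows the ray: the gap changes across both edges that lead from
    \<open>T m\<close> to \<open>T (m + 1)\<close>.\<close>
  have T_in: "T m \<in> range F" if "m \<ge> M" for m
    using that
  proof (induction m rule: int_ge_induct)
    case base
    then show ?case using F0 by (metis rangeI)
  next
    case (step m)
    have "gap (head (T m) i) \<noteq> gap (tail (T m) i)"
      unfolding corners(1) head_T using on[OF step(1)] near[of "m + 1"] step(1) by simp
    then have 1: "nb (T m) i \<in> range F" using closed step.IH by blast
    have "head (nb (T m) i) (i + 1) = head (T (m + 1)) (i + 1)" "tail (nb (T m) i) (i + 1) = tail (T (m + 1)) (i + 1)"
      using corners(4)[of m] head_nb[of "nb (T m) i" "i + 1"] tail_nb[of "nb (T m) i" "i + 1"] by simp_all
    then have "gap (head (nb (T m) i) (i + 1)) \<noteq> gap (tail (nb (T m) i) (i + 1))"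
      unfolding corners(2,3) using on[of "m + 1"] near[of "m + 1"] step(1) by simp
    then show ?case using closed[OF 1, of "i + 1"] unfolding corners(4) by blast
  qed
  have T_inj: "inj T" unfolding inj_def using ray_inj head_T by metis
  have "infinite (range F)"
  proof
    assume "finite (range F)"
    then have "finite (T ` {M..})" using T_in by (elim finite_subset[rotated]) auto
    then show False using T_inj infinite_Ici by (metis finite_imageD inj_on_subset subset_UNIV)
  qed
  then have "inj F" using alternating_orbit_inj F by blast
  then have "starts_and_ends_in_same_sector (\<lambda>n. tri (F n))"
    using sect bi_infinite_pathI[OF double_dimer_pos _ F] by blast
  then obtain q where "finite {n. \<not> tri (F n) \<subseteq> sector q}"
    unfolding starts_and_ends_in_same_sector_def finite_failures_iff_eventually by blast
  define bad where "bad = F ` {n. \<not> tri (F n) \<subseteq> sector q}"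
  have "finite bad" unfolding bad_def using \<open>finite {n. \<not> tri (F n) \<subseteq> sector q}\<close> by simp
  have good: "tri s \<subseteq> sector q" if "s \<in> range F" "s \<notin> bad" for s using that unfolding bad_def by blast
  \<comment> \<open>Triangles on the other side of the ray, in sector \<open>i + 1\<close>; their
    edge \<open>i\<close> joins the ray to that sector.\<close>
  define S where "S m = node_at False i (ray (i + 2) m + step i)" for m
  have head_S: "head (S m) i = ray (i + 2) m + step i" and tail_S: "tail (S m) i = ray (i + 2) m" for m
    by (simp_all add: S_def tail_def)
  have S_inj: "inj S" unfolding inj_def using ray_inj tail_S by metis
  have "finite (T -` bad \<union> S -` bad)" using \<open>finite bad\<close> T_inj S_inj by (simp add: finite_vimageI)
  then obtain m where m: "m \<ge> M" "T m \<notin> bad" "S m \<notin> bad"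
    using infinite_Ici[of M] by (metis UnCI atLeast_iff finite_subset subsetI vimageI2)
  have m_pos: "size_bound < m" "0 < m" using m(1) size_bound_nonneg by (simp_all add: M_def)
  have ray_step: "ray (i + 2) m + step l = line ((\<chi> l. if l = i + 2 then m else 0) + axis l 1)" for l
    by (simp add: ray_def)
  \<comment> \<open>The corner of \<open>T m\<close> beside the ray attains its minimal coordinate
    in position \<open>i\<close> only.\<close>
  have "q = i"
  proof -
    have "real_pt (ray (i + 2) m + step (i + 1)) \<in> sector q"
      using head_in_tri[of "T m" "i + 1"] good[OF T_in[OF m(1)] m(2)] unfolding corners(2) by blast
    then have "((\<chi> l. if l = i + 2 then m else 0) + axis (i + 1) 1) $ q \<le> ((\<chi> l. if l = i + 2 then m else 0) + axis (i + 1) 1) $ i"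
      unfolding ray_step line_in_sector by blast
    then show ?thesis using m_pos index_eq_cases[of q i] by (auto simp: axis_def)
  qed
  \<comment> \<open>By the choice of \<open>m\<close>, a path node \<open>S m\<close> would lie in
    sector \<open>i\<close>, but one of its corners does not.\<close>
  have "S m \<notin> range F"
  proof
    assume "S m \<in> range F"
    then have "real_pt (ray (i + 2) m + step i) \<in> sector i"
      using head_in_tri[of "S m" i] good m(3) \<open>q = i\<close> unfolding head_S by blast
    then have "((\<chi> l. if l = i + 2 then m else 0) + axis i 1) $ i \<le> ((\<chi> l. if l = i + 2 then m else 0) + axis i 1) $ (i + 1)"
      unfolding ray_step line_in_sector by blast
    then show False by (simp add: axis_def)
  qed
  have gap_T: "gap (head (T M) i) = 0" "gap (tail (T M) i) = -1"
    unfolding corners(1) head_T using on near by simp_all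
  have "single (F 0)" using gap_diff[of "T M" i] gap_T unfolding F0 by (auto simp: of_bool_def split: if_splits)
  then have single: "single (F n)" for n using alternating_single F by blast
  have "F (n + 1) \<in> {turn_U (F n), turn_W (F n)}" for n using F[of n] by simp
  then have "same_level (F 0) (F n)" for n using same_level_path[of F n] single by blast
  moreover have "gap (low (F 0)) = -1"
    using gap_corners(3,4)[OF single[of 0], of i] gap_T unfolding F0 by auto
  ultimately have "gap (low (F n)) = -1" for n unfolding same_level_def by simp
  \<comment> \<open>The lower side keeps the gap -1 along the whole path, as
    \<open>component_potential\<close> demands.\<close>
  then have level: "gap (head s l) \<in> {-1, 0} \<and> gap (tail s l) \<in> {-1, 0}" if "s \<in> range F" for s l
    using that gap_corners(3,4)[OF single] by force
  obtain g where g: "\<And>s l. g (head s l) - g (tail s l) = of_bool (s \<in> range F) * (gap (head s l) - gap (tail s l))"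
    and g_linked: "\<And>v v'. linked v v' \<Longrightarrow> g (line v) = g (line v')"
    using component_potential[of "range F"] closed level by metis
  \<comment> \<open>The path passes between these two points, so the potential changes; in the next
    step the edge of \<open>S m\<close> is off the path, so it does not.\<close>
  have 1: "g (ray (i + 2) m + step (i + 1)) - g (ray (i + 2) m) = -1"
    using g[of "T m" "i + 1"] T_in[OF m(1)] on[OF m(1)] near[OF m(1)] unfolding corners(2,3) by simp
  have 2: "g (ray (i + 2) m + step i) - g (ray (i + 2) m) = 0"
    using g[of "S m" i] \<open>S m \<notin> range F\<close> unfolding head_S tail_S by simp
  \<comment> \<open>Beside the ray lie cells of both regions, and each region is connected; if the
    regions were linked, the potential would agree at these cells.\<close>
  have "linked (ray_cell (i + 2) i m) (ray_cell (i + 2) (i + 1) m)"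
    using outer_connected[OF ray_cell_outer w(1), of "i + 2" m] outer_connected[OF w(2) ray_cell_outer, of "i + 2" m]
      \<open>linked w w'\<close> linked_trans m_pos(1) by (metis index_add_distinct(2,3))
  from g_linked[OF this] have "g (ray (i + 2) m + step (i + 1)) = g (ray (i + 2) m + step i)"
    using line_ray_cell[of i "i + 1" "i + 2" m] line_ray_cell[of "i + 1" i "i + 2" m] by simp
  then show False using 1 2 by simp
qed

text \<open>Of two different indices modulo 3, one is the successor of the other, so it suffices to
  separate neighbouring sectors.\<close>

lemma labelled_if_same_sector:
  assumes "\<And>f. bi_infinite_path (double_dimer \<mu> A B) f \<Longrightarrow> starts_and_ends_in_same_sector f"
  shows "labelled_AB_configuration \<mu> A B"
  unfolding labelled_iff_outer_separated
proof (intro allI ballI impI)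
  fix i j w w' assume w: "w \<in> outer i" "w' \<in> outer j" "linked w w'"
  have "j \<noteq> i + 1" using neighbouring_sectors_separated[OF assms w(1)] w by blast
  moreover have "j \<noteq> i + 2"
  proof
    assume "j = i + 2"
    then have "i = j + 1" by simp
    then show False using neighbouring_sectors_separated[OF assms w(2)] w linked_sym by blast
  qed
  ultimately show "i = j" using index_eq_cases[of j i] by auto
qed

end

theorem theorem3:
  fixes \<mu> :: "3 \<Rightarrow> nat list" and A B :: "cell set"
  assumes "\<And>i. is_partition (\<mu> i)"
    and "AB_configuration \<mu> A B"
  shows "labelled_AB_configuration \<mu> A B \<longleftrightarrow>
    (\<forall>f. bi_infinite_path (double_dimer \<mu> A B) f \<longrightarrow> starts_and_ends_in_same_sector f)"
proof -
  interpret AB_pair \<mu> A B using assms by unfold_locales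
  show ?thesis using same_sector_if_labelled labelled_if_same_sector by blast
qed

end
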